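(* Let $\kappa>0$ and $\lambda\in(0,1)$. Consider erasure queue-channels with erasure probability $p(W)=1-\exp(-\kappa W)$ and Poisson arrivals of rate $\lambda$ (interarrival distribution $F_A(x)=1-\exp(-\lambda x)$). Among all service time distributions $F_S$ with unit mean and $F_S(0)=0$, the capacity is maximized by $F_S(x)=\mathbf{1}(x\ge1)$, i.e., by a deterministic service time.
   Context: Queue. Symbols (qubits) $j=1,2,\dots$ arrive at a single-server FIFO queue. Interarrival times are i.i.d. with distribution $F_A$; service times $S_j$ are i.i.d. with distribution $F_S$ on $[0,\infty)$, independent of the arrivals. The first symbol arrives to an empty system. $A_j$ is the arrival time of symbol $j$, $D_j$ is the time it leaves the waiting line (its service start), and $W_j=D_j-A_j$ is its waiting time. Thus $W_1=0$ and $W_{j+1}=\max(W_j+S_j-(A_{j+1}-A_j),0)$. Channel. The input alphabet $\mathcal{X}$ is finite and fixed. The inputs $X^n=(X_1,\dots,X_n)\in\mathcal{X}^n$ are independent of the arrival and service times. Given $X^n$ and all arrival and service times, the outputs $Y_1,\dots,Y_n$ are independent, with $Y_j=X_j$ with probability $1-p(W_j)$ and $Y_j=\mathcal{E}$ (an erasure symbol not in $\mathcal{X}$) with probability $p(W_j)$. Capacity (bits/sec). An $(n,\tilde R,T)$ code consists of a message set $\mathcal{M}$ with $|\mathcal{M}|=2^{n\tilde R}$, an encoder $X^n=f(M)$ and a decoder $\hat M=g(\cdot)$ acting on $(Y^n,A^n,D^n)$ if the receiver knows the arrival and departure times, and on $Y^n$ only if it does not (the claim is meant in either case); $M$ is uniform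 on $\mathcal{M}$ and the expected time by which all $n$ symbols have been served is less than $T$. A rate $R$ is achievable if for all $\epsilon\in(0,1)$ and $\delta>0$, for all sufficiently large $n$ there is an $(n,\tilde R,T)$ code with $\Pr[\hat M\ne M]<\epsilon$ and $n\tilde R/T>R-\delta$. The capacity is the supremum of achievable rates. *)

theory Defs
  imports "HOL-Probability.Probability"
begin

text \<open>
  Symbols are numbered from 0, so index \<open>j\<close> is the \<open>(j+1)\<close>-st symbol and a block of length
  \<open>n\<close> has index set \<open>{..<n}\<close>. A timing sample is a pair \<open>(\<tau>, s)\<close>: \<open>\<tau> 0\<close> is the time from the
  origin to the first arrival, \<open>\<tau> (j+1)\<close> the time between the arrivals \<open>j\<close> and \<open>j+1\<close>, and
  \<open>s j\<close> the service time of symbol \<open>j\<close>.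
\<close>

definition arrival :: "(nat \<Rightarrow> real) \<times> (nat \<Rightarrow> real) \<Rightarrow> nat \<Rightarrow> real" where
  "arrival \<omega> j = (\<Sum>i\<le>j. fst \<omega> i)"

primrec waiting :: "(nat \<Rightarrow> real) \<times> (nat \<Rightarrow> real) \<Rightarrow> nat \<Rightarrow> real" where
  "waiting \<omega> 0 = 0"
| "waiting \<omega> (Suc j) =
     max (waiting \<omega> j + snd \<omega> j - (arrival \<omega> (Suc j) - arrival \<omega> j)) 0"

text \<open>Departure from the waiting line, i.e. the start (not the end) of service.\<close>

definition departure :: "(nat \<Rightarrow> real) \<times> (nat \<Rightarrow> real) \<Rightarrow> nat \<Rightarrow> real" where
  "departure \<omega> j = arrival \<omega> j + waiting \<omega> j"

definition completion :: "nat \<Rightarrow> (nat \<Rightarrow> real) \<times> (nat \<Rightarrow> real) \<Rightarrow> real" where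
  "completion n \<omega> = (MAX j\<in>{..<n}. departure \<omega> j + snd \<omega> j)"

definition timing :: "real measure \<Rightarrow> real measure \<Rightarrow> ((nat \<Rightarrow> real) \<times> (nat \<Rightarrow> real)) measure" where
  "timing FA FS = (\<Pi>\<^sub>M j\<in>UNIV. FA) \<Otimes>\<^sub>M (\<Pi>\<^sub>M j\<in>UNIV. FS)"

text \<open>The output alphabet is \<^typ>\<open>'x option\<close>, where \<^term>\<open>None\<close> is the erasure symbol.\<close>

definition erasure_pmf :: "real \<Rightarrow> 'x \<Rightarrow> 'x option pmf" where
  "erasure_pmf q x = map_pmf (\<lambda>erased. if erased then None else Some x) (bernoulli_pmf q)"

definition output_law ::
  "(real \<Rightarrow> real) \<Rightarrow> nat \<Rightarrow> (nat \<Rightarrow> 'x) \<Rightarrow> (nat \<Rightarrow> real) \<times> (nat \<Rightarrow> real) \<Rightarrow> (nat \<Rightarrow> 'x option) measure" where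
  "output_law p n x \<omega> = (\<Pi>\<^sub>M j\<in>{..<n}. measure_pmf (erasure_pmf (p (waiting \<omega> j)) (x j)))"

type_synonym 'x observation = "(nat \<Rightarrow> 'x option) \<times> (nat \<Rightarrow> real) \<times> (nat \<Rightarrow> real)"

definition observation_space :: "nat \<Rightarrow> 'x observation measure" where
  "observation_space n =
     (\<Pi>\<^sub>M j\<in>{..<n}. count_space UNIV) \<Otimes>\<^sub>M (\<Pi>\<^sub>M j\<in>{..<n}. borel) \<Otimes>\<^sub>M (\<Pi>\<^sub>M j\<in>{..<n}. borel)"

definition observe ::
  "nat \<Rightarrow> (nat \<Rightarrow> real) \<times> (nat \<Rightarrow> real) \<Rightarrow> (nat \<Rightarrow> 'x option) \<Rightarrow> 'x observation" where
  "observe n \<omega> y = (y, restrict (arrival \<omega>) {..<n}, restrict (departure \<omega>) {..<n})"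

text \<open>
  The flag \<open>timed\<close> says whether the receiver knows the arrival and departure times; if it does
  not, the decoder must be a function of the channel outputs alone.
\<close>

definition queue_code ::
  "bool \<Rightarrow> real measure \<Rightarrow> real measure \<Rightarrow> nat \<Rightarrow> real \<Rightarrow> real \<Rightarrow>
   nat set \<Rightarrow> (nat \<Rightarrow> nat \<Rightarrow> 'x) \<Rightarrow> ('x observation \<Rightarrow> nat) \<Rightarrow> bool" where
  "queue_code timed FA FS n Rt T Msg f g \<longleftrightarrow>
     finite Msg \<and> real (card Msg) = 2 powr (real n * Rt) \<and>
     f \<in> Msg \<rightarrow> ({..<n} \<rightarrow>\<^sub>E UNIV) \<and>
     g \<in> observation_space n \<rightarrow>\<^sub>M count_space Msg \<and>
     (timed \<or> (\<exists>h. \<forall>y a d. g (y, a, d) = h y)) \<and>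
     integrable (timing FA FS) (completion n) \<and>
     (\<integral>\<omega>. completion n \<omega> \<partial>timing FA FS) < T"

text \<open>
  The probability of a decoding error, for a uniformly distributed message: given the message
  and the timing, the outputs follow \<^const>\<open>output_law\<close>, and the resulting conditional error
  probability is averaged over messages and timing, which are independent. The function \<open>p\<close>
  is understood to be Borel measurable with values in the unit interval.
\<close>

definition error_prob ::
  "(real \<Rightarrow> real) \<Rightarrow> real measure \<Rightarrow> real measure \<Rightarrow> nat \<Rightarrow>
   nat set \<Rightarrow> (nat \<Rightarrow> nat \<Rightarrow> 'x) \<Rightarrow> ('x observation \<Rightarrow> nat) \<Rightarrow> real" where
  "error_prob p FA FS n Msg f g =
     (\<Sum>m\<in>Msg. \<integral>\<omega>. measure (output_law p n (f m) \<omega>)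
                     {y \<in> space (output_law p n (f m) \<omega>). g (observe n \<omega> y) \<noteq> m}
                 \<partial>timing FA FS) / real (card Msg)"

definition achievable ::
  "'x::finite itself \<Rightarrow> bool \<Rightarrow> (real \<Rightarrow> real) \<Rightarrow> real measure \<Rightarrow> real measure \<Rightarrow> real \<Rightarrow> bool" where
  "achievable _ timed p FA FS R \<longleftrightarrow>
     (\<forall>\<epsilon>\<in>{0<..<1}. \<forall>\<delta>>0. \<forall>\<^sub>F n in sequentially.
        \<exists>Rt T Msg (f :: nat \<Rightarrow> nat \<Rightarrow> 'x) g.
          queue_code timed FA FS n Rt T Msg f g \<and>
          error_prob p FA FS n Msg f g < \<epsilon> \<and>
          real n * Rt / T > R - \<delta>)"

text \<open>
  An extended real, so that the supremum needs no boundedness or nonemptiness proviso.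
\<close>

definition capacity ::
  "'x::finite itself \<Rightarrow> bool \<Rightarrow> (real \<Rightarrow> real) \<Rightarrow> real measure \<Rightarrow> real measure \<Rightarrow> ereal" where
  "capacity X timed p FA FS = (SUP R\<in>{R. achievable X timed p FA FS R}. ereal R)"

definition exponential :: "real \<Rightarrow> real measure" where
  "exponential l = density lborel (\<lambda>x. ennreal (exponential_density l x))"

text \<open>\<open>cdf FS 0 = 0\<close> includes that the service time is almost surely nonnegative.\<close>

definition unit_mean_service :: "real measure \<Rightarrow> bool" where
  "unit_mean_service FS \<longleftrightarrow>
     real_distribution FS \<and> cdf FS 0 = 0 \<and>
     integrable FS (\<lambda>x. x) \<and> (\<integral>x. x \<partial>FS) = 1"

lemma cdf_exponential:
  assumes "l > 0"
  shows "cdf (exponential l) x = (if x \<ge> 0 then 1 - exp (- l * x) else 0)"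
proof -
  have "cdf (exponential l) x = enn2real (ennreal (erlang_CDF 0 l x))"
    by (simp add: cdf_def measure_def exponential_def emeasure_density
        nn_integral_erlang_density[OF assms])
  then show ?thesis
    using assms by (auto simp: erlang_CDF_def mult.commute)
qed

lemma cdf_deterministic: "cdf (return borel 1) x = (if x \<ge> 1 then 1 else 0)" for x :: real
  by (simp add: cdf_def measure_return)

end

theory Submission
  imports Defs
begin

text \<open>
  For every unit-mean service law the capacity equals \<open>lam * log 2 |X| * \<pi>\<close>, where \<open>\<pi>\<close> is the
  long-run fraction of symbols that survive, i.e. the average of \<open>E exp (- \<kappa> W\<^sub>j)\<close>.

  With exponential interarrival times, \<open>\<phi>\<^sub>j(s) = E exp (- s W\<^sub>j)\<close> and the service transform \<open>L\<close>,
  integrating out one arrival gives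
  \<open>(s - lam) \<phi>\<^sub>j\<^sub>+\<^sub>1(s) + lam L(s) \<phi>\<^sub>j(s) = s L(lam) \<phi>\<^sub>j(lam)\<close> for all \<open>s > 0\<close>. Averaging over \<open>j\<close> and
  combining \<open>E W\<^sub>j \<ge> 0\<close> with \<open>s \<rightarrow> 0\<close> identifies the limit of the right-hand side, hence
  \<open>\<pi> = (1 - lam) \<kappa> / (\<kappa> - lam + lam L(\<kappa>))\<close>.

  The converse counts: when \<open>k\<close> symbols survive, at most \<open>|X|^k\<close> messages can be decoded correctly.
  For achievability, a uniformly random codebook works as soon as the number of surviving symbols
  concentrates. Restarting the queue from empty at time \<open>i\<close> only shortens later waits, so
  \<open>E exp (- \<kappa> (W\<^sub>i + W\<^sub>i\<^sub>+\<^sub>k)) \<le> \<phi>\<^sub>i(\<kappa>) \<phi>\<^sub>k(\<kappa>)\<close>; this bounds the second moment by the square of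
  the mean to leading order, and Chebyshev applies.

  By Jensen, \<open>L(\<kappa>) \<ge> exp (- \<kappa>)\<close> with equality for deterministic service, which maximises \<open>\<pi>\<close>.
\<close>

section \<open>Erasure patterns and coding\<close>

text \<open>\<open>u j\<close> is the probability that symbol \<open>j\<close> survives, \<open>E\<close> the set of symbols that do.\<close>

definition pattern_weight :: "(nat \<Rightarrow> real) \<Rightarrow> nat \<Rightarrow> nat set \<Rightarrow> real" where
  "pattern_weight u n E = (\<Prod>j\<in>E. u j) * (\<Prod>j\<in>{..<n} - E. 1 - u j)"

definition received :: "nat \<Rightarrow> nat set \<Rightarrow> (nat \<Rightarrow> 'x) \<Rightarrow> nat \<Rightarrow> 'x option" where
  "received n E x = (\<lambda>j\<in>{..<n}. if j \<in> E then Some (x j) else None)"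

lemma pattern_weight_nonneg:
  assumes "\<And>j. j < n \<Longrightarrow> 0 \<le> u j \<and> u j \<le> 1" "E \<subseteq> {..<n}"
  shows "0 \<le> pattern_weight u n E"
  using assms by (auto simp: pattern_weight_def intro!: mult_nonneg_nonneg prod_nonneg)

lemma pattern_weight_le_1:
  assumes "\<And>j. j < n \<Longrightarrow> 0 \<le> u j \<and> u j \<le> 1" "E \<subseteq> {..<n}"
  shows "pattern_weight u n E \<le> 1"
proof -
  have "(\<Prod>j\<in>E. u j) \<le> 1" "(\<Prod>j\<in>{..<n} - E. 1 - u j) \<le> 1"
    "0 \<le> (\<Prod>j\<in>{..<n} - E. 1 - u j)"
    using assms by (auto intro!: prod_le_1 prod_nonneg)
  then show ?thesis
    unfolding pattern_weight_def by (intro mult_le_one)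
qed

text \<open>Expanding the product of \<open>u j + b j\<close> over \<open>j < n\<close> gives one
  term per subset \<open>E\<close>. With \<open>b\<close> equal to 0 on \<open>A\<close>, the terms
  whose \<open>E\<close> misses a point of \<open>A\<close> vanish. Empty, one-element and
  two-element \<open>A\<close> yield the total mass and the first two moments of the number of
  survivors.\<close>

lemma sum_pattern_weight_superset:
  assumes "A \<subseteq> {..<n}"
  shows "(\<Sum>E\<in>Pow {..<n}. pattern_weight u n E * of_bool (A \<subseteq> E)) = (\<Prod>j\<in>A. u j)"
proof -
  define b where "b j = (if j \<in> A then 0 else 1 - u j)" for j
  have "(\<Prod>j\<in>A. u j) = (\<Prod>j\<in>{..<n}. if j \<in> A then u j else 1)"
    using assms by (simp add: prod.If_cases Int_absorb1)
  also have "\<dots> = (\<Prod>j\<in>{..<n}. u j + b j)"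
    by (intro prod.cong) (auto simp: b_def)
  also have "\<dots> = (\<Sum>E\<in>Pow {..<n}. (\<Prod>j\<in>E. u j) * (\<Prod>j\<in>{..<n} - E. b j))"
    by (rule prod_add) simp
  also have "\<dots> = (\<Sum>E\<in>Pow {..<n}. pattern_weight u n E * of_bool (A \<subseteq> E))"
  proof (intro sum.cong refl)
    fix E assume E: "E \<in> Pow {..<n}"
    show "(\<Prod>j\<in>E. u j) * (\<Prod>j\<in>{..<n} - E. b j) = pattern_weight u n E * of_bool (A \<subseteq> E)"
    proof (cases "A \<subseteq> E")
      case True
      then have "(\<Prod>j\<in>{..<n} - E. b j) = (\<Prod>j\<in>{..<n} - E. 1 - u j)"
        by (intro prod.cong) (auto simp: b_def)
      then show ?thesis using True by (simp add: pattern_weight_def)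
    next
      case False
      then obtain a where "a \<in> A" "a \<notin> E" by auto
      then have "a \<in> {..<n} - E" "b a = 0" using assms by (auto simp: b_def)
      then have "(\<Prod>j\<in>{..<n} - E. b j) = 0" by (intro prod_zero) auto
      then show ?thesis using False by simp
    qed
  qed
  finally show ?thesis ..
qed

lemma sum_pattern_weight: "(\<Sum>E\<in>Pow {..<n}. pattern_weight u n E) = 1"
  using sum_pattern_weight_superset[of "{}" n u] by simp

lemma card_eq_sum_of_bool:
  fixes n :: nat
  assumes "E \<subseteq> {..<n}"
  shows "real (card E) = (\<Sum>j<n. of_bool (j \<in> E))"
proof -
  have "{..<n} \<inter> E = E" using assms by auto
  then show ?thesis by simp
qed

lemma sum_pattern_weight_card:
  "(\<Sum>E\<in>Pow {..<n}. pattern_weight u n E * card E) = (\<Sum>j<n. u j)"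
proof -
  have "(\<Sum>E\<in>Pow {..<n}. pattern_weight u n E * card E) =
     (\<Sum>E\<in>Pow {..<n}. \<Sum>j<n. pattern_weight u n E * of_bool ({j} \<subseteq> E))"
    by (intro sum.cong refl) (simp add: card_eq_sum_of_bool sum_distrib_left)
  also have "\<dots> = (\<Sum>j<n. \<Sum>E\<in>Pow {..<n}. pattern_weight u n E * of_bool ({j} \<subseteq> E))"
    by (rule sum.swap)
  also have "\<dots> = (\<Sum>j<n. u j)"
    by (intro sum.cong refl, subst sum_pattern_weight_superset) auto
  finally show ?thesis .
qed

text \<open>The product runs over the set \<open>{i, j}\<close>, so that a diagonal term is
  \<open>u i\<close> and not its square.\<close>

lemma sum_pattern_weight_card_square:
  "(\<Sum>E\<in>Pow {..<n}. pattern_weight u n E * (real (card E))\<^sup>2) = (\<Sum>i<n. \<Sum>j<n. \<Prod>k\<in>{i, j}. u k)"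
proof -
  have "(\<Sum>E\<in>Pow {..<n}. pattern_weight u n E * (real (card E))\<^sup>2) =
     (\<Sum>E\<in>Pow {..<n}. \<Sum>i<n. \<Sum>j<n. pattern_weight u n E * of_bool ({i, j} \<subseteq> E))"
  proof (intro sum.cong refl)
    fix E assume "E \<in> Pow {..<n}"
    then have E: "E \<subseteq> {..<n}" by simp
    show "pattern_weight u n E * (real (card E))\<^sup>2 =
        (\<Sum>i<n. \<Sum>j<n. pattern_weight u n E * of_bool ({i, j} \<subseteq> E))"
      unfolding card_eq_sum_of_bool[OF E] power2_eq_square sum_product sum_distrib_left
      by (intro sum.cong refl) (simp add: of_bool_conj)
  qed
  also have "\<dots> = (\<Sum>i<n. \<Sum>E\<in>Pow {..<n}. \<Sum>j<n. pattern_weight u n E * of_bool ({i, j} \<subseteq> E))"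
    by (rule sum.swap)
  also have "\<dots> = (\<Sum>i<n. \<Sum>j<n. \<Sum>E\<in>Pow {..<n}. pattern_weight u n E * of_bool ({i, j} \<subseteq> E))"
    by (intro sum.cong refl sum.swap)
  also have "\<dots> = (\<Sum>i<n. \<Sum>j<n. \<Prod>k\<in>{i, j}. u k)"
    by (intro sum.cong refl, subst sum_pattern_weight_superset) auto
  finally show ?thesis .
qed

section \<open>Output words and the erasure patterns that produce them\<close>

lemma pmf_erasure_pmf:
  assumes "0 \<le> q" "q \<le> 1"
  shows "pmf (erasure_pmf q x) y = (if y = None then q else if y = Some x then 1 - q else 0)"
proof -
  have 1: "pmf (erasure_pmf q x) y = measure (bernoulli_pmf q) {b. (if b then None else Some x) = y}"
    by (simp add: erasure_pmf_def pmf_map vimage_def)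
  have "{b. (if b then None else Some x) = y} =
      (if y = None then {True} else if y = Some x then {False} else {})"
    by (auto split: if_splits)
  then show ?thesis
    unfolding 1 using assms by (auto simp: measure_pmf_single)
qed

lemma received_in_PiE: "received n E x \<in> {..<n} \<rightarrow>\<^sub>E UNIV"
  by (simp add: received_def)

lemma received_eq_None_iff: "j < n \<Longrightarrow> received n E x j = None \<longleftrightarrow> j \<notin> E"
  by (simp add: received_def)

lemma inj_on_received: "inj_on (\<lambda>E. received n E x) (Pow {..<n})"
proof (rule inj_onI)
  fix E F assume "E \<in> Pow {..<n}" "F \<in> Pow {..<n}" "received n E x = received n F x"
  then show "E = F"
    by (metis PowD lessThan_iff received_eq_None_iff subsetD subsetI subset_antisym)
qed

lemma prod_pmf_received:
  assumes "\<And>j. j < n \<Longrightarrow> 0 \<le> q j \<and> q j \<le> 1" "E \<subseteq> {..<n}"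
  shows "(\<Prod>j<n. pmf (erasure_pmf (q j) (x j)) (received n E x j)) = pattern_weight (\<lambda>j. 1 - q j) n E"
proof -
  have "(\<Prod>j<n. pmf (erasure_pmf (q j) (x j)) (received n E x j)) = (\<Prod>j<n. if j \<in> E then 1 - q j else q j)"
    using assms(1) by (intro prod.cong refl) (simp add: pmf_erasure_pmf received_def)
  also have "\<dots> = (\<Prod>j\<in>{..<n} \<inter> E. 1 - q j) * (\<Prod>j\<in>{..<n} \<inter> - E. q j)"
    by (simp add: prod.If_cases)
  also have "\<dots> = pattern_weight (\<lambda>j. 1 - q j) n E"
    using assms(2) by (simp add: pattern_weight_def Int_absorb1 Diff_eq)
  finally show ?thesis .
qed

text \<open>If no factor vanished, \<open>y\<close> would agree with \<open>x\<close> at every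
  position that is not erased, and would then be the word received when exactly those positions
  survive.\<close>

lemma prod_pmf_not_received:
  assumes "\<And>j. j < n \<Longrightarrow> 0 \<le> q j \<and> q j \<le> 1" "y \<in> {..<n} \<rightarrow>\<^sub>E UNIV"
    "y \<notin> (\<lambda>E. received n E x) ` Pow {..<n}"
  shows "(\<Prod>j<n. pmf (erasure_pmf (q j) (x j)) (y j)) = 0"
proof -
  have "\<exists>j<n. y j \<noteq> None \<and> y j \<noteq> Some (x j)"
  proof (rule ccontr)
    assume *: "\<not> (\<exists>j<n. y j \<noteq> None \<and> y j \<noteq> Some (x j))"
    have "y = received n {j\<in>{..<n}. y j \<noteq> None} x"
    proof
      fix j show "y j = received n {j\<in>{..<n}. y j \<noteq> None} x j"
        using * assms(2) by (cases "j < n") (auto simp: received_def PiE_def extensional_def)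
    qed
    with assms(3) show False by blast
  qed
  then obtain j where j: "j < n" "y j \<noteq> None" "y j \<noteq> Some (x j)" by blast
  then have "pmf (erasure_pmf (q j) (x j)) (y j) = 0"
    using assms(1)[of j] by (subst pmf_erasure_pmf) auto
  with j(1) show ?thesis by (intro prod_zero) auto
qed

text \<open>Replaces the product measure by a finite sum: only words \<open>received n E x\<close>
  carry mass, and they correspond one to one to the patterns \<open>E\<close>. The predicate
  \<open>Q\<close> is arbitrary because the output space is finite with measurable points.\<close>

lemma measure_output_law:
  fixes x :: "nat \<Rightarrow> 'x::finite"
  assumes "\<And>j. j < n \<Longrightarrow> 0 \<le> p (waiting \<omega> j) \<and> p (waiting \<omega> j) \<le> 1"
  shows "measure (output_law p n x \<omega>) {y \<in> space (output_law p n x \<omega>). Q y} =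
    (\<Sum>E\<in>Pow {..<n}. pattern_weight (\<lambda>j. 1 - p (waiting \<omega> j)) n E * of_bool (Q (received n E x)))"
proof -
  let ?M = "\<lambda>j. measure_pmf (erasure_pmf (p (waiting \<omega> j)) (x j))"
  let ?\<pi> = "\<lambda>y. \<Prod>j<n. pmf (erasure_pmf (p (waiting \<omega> j)) (x j)) (y j)"
  interpret product_prob_space ?M "{..<n}"
    by unfold_locales
  interpret F: finite_product_prob_space ?M "{..<n}"
    by unfold_locales simp
  have single: "measure (Pi\<^sub>M {..<n} ?M) {y} = ?\<pi> y" "{y} \<in> sets (Pi\<^sub>M {..<n} ?M)"
    if "y \<in> {..<n} \<rightarrow>\<^sub>E UNIV" for y
  proof -
    have y: "{y} = (\<Pi>\<^sub>E j\<in>{..<n}. {y j})"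
      using that by (intro set_eqI iffI) (auto intro: PiE_ext)
    show "measure (Pi\<^sub>M {..<n} ?M) {y} = ?\<pi> y"
      unfolding y by (subst F.finite_measure_PiM_emb) (auto simp: measure_pmf_single)
    show "{y} \<in> sets (Pi\<^sub>M {..<n} ?M)"
      unfolding y by (rule sets_PiM_I_finite) auto
  qed
  have space: "space (output_law p n x \<omega>) = {..<n} \<rightarrow>\<^sub>E UNIV"
    by (simp add: output_law_def space_PiM)
  let ?B = "{y \<in> {..<n} \<rightarrow>\<^sub>E UNIV. Q y}"
  have fin: "finite ({..<n} \<rightarrow>\<^sub>E (UNIV :: 'x option set))" by (simp add: finite_PiE)
  have "measure (output_law p n x \<omega>) {y \<in> space (output_law p n x \<omega>). Q y} = (\<Sum>y\<in>?B. ?\<pi> y)"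
    unfolding space unfolding output_law_def using fin single
    by (subst finite_measure_eq_sum_singleton) auto
  also have "\<dots> = (\<Sum>y\<in>{..<n} \<rightarrow>\<^sub>E UNIV. ?\<pi> y * of_bool (Q y))"
    using fin by (intro sum.mono_neutral_cong_left) auto
  also have "\<dots> = (\<Sum>y\<in>(\<lambda>E. received n E x) ` Pow {..<n}. ?\<pi> y * of_bool (Q y))"
    using fin prod_pmf_not_received[of n "\<lambda>j. p (waiting \<omega> j)" _ x] assms
    by (intro sum.mono_neutral_right) (auto intro!: received_in_PiE simp del: PiE_iff)
  also have "\<dots> = (\<Sum>E\<in>Pow {..<n}. ?\<pi> (received n E x) * of_bool (Q (received n E x)))"
    by (subst sum.reindex[OF inj_on_received]) simp
  also have "\<dots> = (\<Sum>E\<in>Pow {..<n}. pattern_weight (\<lambda>j. 1 - p (waiting \<omega> j)) n E * of_bool (Q (received n E x)))"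
    using prod_pmf_received[of n "\<lambda>j. p (waiting \<omega> j)" _ x] assms by (intro sum.cong refl) auto
  finally show ?thesis .
qed

section \<open>Counting bound for decoders and random codebooks\<close>

text \<open>Codewords that coincide on \<open>E\<close> produce the same output and hence the same
  decision, so a correctly decoded message is determined by its codeword on \<open>E\<close>. A
  decoder that knows the times is covered by fixing the times first.\<close>

lemma card_correctly_decoded_le:
  fixes f :: "nat \<Rightarrow> nat \<Rightarrow> 'x::finite"
  assumes "finite Msg" "E \<subseteq> {..<n}"
  shows "(\<Sum>m\<in>Msg. of_bool (g (received n E (f m)) = m)) \<le> real CARD('x) ^ card E"
proof -
  let ?C = "{m\<in>Msg. g (received n E (f m)) = m}"
  have fE: "finite E" using assms(2) finite_subset by blast
  have "inj_on (\<lambda>m. restrict (f m) E) ?C"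
  proof (rule inj_onI)
    fix m m' assume mm: "m \<in> ?C" "m' \<in> ?C" "restrict (f m) E = restrict (f m') E"
    then have "\<And>j. j \<in> E \<Longrightarrow> f m j = f m' j" by (metis restrict_apply')
    then have "received n E (f m) = received n E (f m')" by (auto simp: received_def)
    with mm show "m = m'" by auto
  qed
  then have "card ?C \<le> card (E \<rightarrow>\<^sub>E (UNIV :: 'x set))"
    using fE by (intro card_inj_on_le) (auto intro: finite_PiE)
  also have "\<dots> = CARD('x) ^ card E" using fE by (simp add: card_PiE)
  finally have "real (card ?C) \<le> real (CARD('x) ^ card E)" by (rule of_nat_mono)
  then have "real (card ?C) \<le> real CARD('x) ^ card E" by simp
  moreover have "(\<Sum>m\<in>Msg. of_bool (g (received n E (f m)) = m)) = real (card ?C)"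
    using assms(1) by (simp add: of_bool_def sum.If_cases Int_def)
  ultimately show ?thesis by simp
qed

text \<open>In a uniformly random codebook two different codewords coincide on \<open>E\<close> with
  probability \<open>1 / CARD('x) ^ card E\<close>. All codewords except that of \<open>m'\<close>
  are held fixed; the latter is then free only at the \<open>n - card E\<close> positions outside
  \<open>E\<close>.\<close>

lemma card_codebooks_agreeing:
  fixes n :: nat
  assumes "finite I" "m \<in> I" "m' \<in> I" "m \<noteq> m'" "E \<subseteq> {..<n}"
  defines "Cb \<equiv> I \<rightarrow>\<^sub>E ({..<n} \<rightarrow>\<^sub>E (UNIV :: 'x::finite set))"
  shows "(\<Sum>f\<in>Cb. of_bool (\<forall>j\<in>E. f m' j = f m j)) * real CARD('x) ^ card E = real (card Cb)"
proof -
  let ?S = "{..<n} \<rightarrow>\<^sub>E (UNIV :: 'x set)"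
  let ?J = "I - {m'}"
  let ?c = "real CARD('x)"
  have I: "I = insert m' ?J" "m' \<notin> ?J" using assms by auto
  have fS: "finite ?S" by (simp add: finite_PiE)
  have cE: "card E \<le> n" using assms(5) by (metis card_lessThan card_mono finite_lessThan)
  have cnt: "(\<Sum>b\<in>?S. of_bool (\<forall>j\<in>E. b j = a j)) = ?c ^ (n - card E)" for a :: "nat \<Rightarrow> 'x"
  proof -
    have "{b\<in>?S. \<forall>j\<in>E. b j = a j} = (\<Pi>\<^sub>E j\<in>{..<n}. if j \<in> E then {a j} else UNIV)"
      using assms(5) by (fastforce simp: PiE_def Pi_def extensional_def)
    moreover have "card (\<Pi>\<^sub>E j\<in>{..<n}. if j \<in> E then {a j} else UNIV) = (\<Prod>j<n. if j \<in> E then 1 else CARD('x))"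
      by (subst card_PiE) (auto intro!: prod.cong)
    moreover have "(\<Prod>j<n. if j \<in> E then 1 else CARD('x)) = CARD('x) ^ (n - card E)"
      using assms(5) cE by (simp add: prod.If_cases card_Diff_subset finite_subset[OF assms(5)] flip: Diff_eq)
    ultimately show ?thesis using fS by (simp add: of_bool_def sum.If_cases Int_def)
  qed
  have inj: "inj_on (\<lambda>(y, h). h(m' := y)) (?S \<times> (?J \<rightarrow>\<^sub>E ?S))"
    by (rule inj_combinator[OF I(2)])
  have Cb: "Cb = (\<lambda>(y, h). h(m' := y)) ` (?S \<times> (?J \<rightarrow>\<^sub>E ?S))"
    unfolding Cb_def by (subst I(1)) (rule PiE_insert_eq)
  have "(\<Sum>f\<in>Cb. of_bool (\<forall>j\<in>E. f m' j = f m j)) =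
      (\<Sum>(y, h)\<in>?S \<times> (?J \<rightarrow>\<^sub>E ?S). of_bool (\<forall>j\<in>E. y j = h m j))"
    unfolding Cb by (subst sum.reindex[OF inj]) (auto intro!: sum.cong simp: assms(4))
  also have "\<dots> = (\<Sum>h\<in>?J \<rightarrow>\<^sub>E ?S. \<Sum>y\<in>?S. of_bool (\<forall>j\<in>E. y j = h m j))"
    by (subst sum.cartesian_product[symmetric]) (rule sum.swap)
  also have "\<dots> = real (card (?J \<rightarrow>\<^sub>E ?S)) * ?c ^ (n - card E)"
    by (simp add: cnt)
  finally have "(\<Sum>f\<in>Cb. of_bool (\<forall>j\<in>E. f m' j = f m j)) * ?c ^ card E =
     real (card (?J \<rightarrow>\<^sub>E ?S)) * ?c ^ n"
    using cE by (simp flip: power_add)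
  also have "\<dots> = real (card Cb)"
    unfolding Cb by (subst card_image[OF inj]) (simp add: card_cartesian_product card_PiE)
  finally show ?thesis .
qed

text \<open>The decoder looks only at the channel outputs, so one code serves receivers with and
  without timing knowledge. The default 0 keeps the value below \<open>M\<close> whenever
  \<open>0 < M\<close>.\<close>

definition first_compatible :: "nat \<Rightarrow> nat \<Rightarrow> (nat \<Rightarrow> nat \<Rightarrow> 'x) \<Rightarrow> (nat \<Rightarrow> 'x option) \<Rightarrow> nat" where
  "first_compatible n M f y =
     (if \<exists>m<M. \<forall>j<n. y j \<noteq> None \<longrightarrow> y j = Some (f m j)
      then LEAST m. m < M \<and> (\<forall>j<n. y j \<noteq> None \<longrightarrow> y j = Some (f m j)) else 0)"

lemma first_compatible_less: "0 < M \<Longrightarrow> first_compatible n M f y < M"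
  unfolding first_compatible_def by (auto intro: LeastI2)

text \<open>The true message is always compatible with what is received. A wrong decision therefore
  exhibits a rival codeword that agrees with the true one on \<open>E\<close>, and the sum is the
  union bound over rivals.\<close>

lemma first_compatible_error:
  assumes "m < M" "E \<subseteq> {..<n}"
  shows "of_bool (first_compatible n M f (received n E (f m)) \<noteq> m) \<le>
    (\<Sum>m'\<in>{..<M} - {m}. of_bool (\<forall>j\<in>E. f m' j = f m j) :: real)"
proof (cases "first_compatible n M f (received n E (f m)) = m")
  case False
  let ?P = "\<lambda>m'. m' < M \<and> (\<forall>j<n. received n E (f m) j \<noteq> None \<longrightarrow> received n E (f m) j = Some (f m' j))"
  define m' where "m' = first_compatible n M f (received n E (f m))"
  have "?P m" using assms by (auto simp: received_def)
  then have "m' = (LEAST m'. ?P m')"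
    unfolding m'_def first_compatible_def by auto
  with LeastI[of ?P, OF \<open>?P m\<close>] have "?P m'" by simp
  then have "m' < M" "\<forall>j\<in>E. f m' j = f m j"
    using assms(2) by (auto simp: received_def split: if_splits)
  moreover have "m' \<noteq> m" using False by (simp add: m'_def)
  ultimately have "1 \<le> (\<Sum>m'\<in>{..<M} - {m}. of_bool (\<forall>j\<in>E. f m' j = f m j) :: real)"
    using member_le_sum[of m' "{..<M} - {m}" "\<lambda>m'. of_bool (\<forall>j\<in>E. f m' j = f m j) :: real"] by simp
  then show ?thesis using False by simp
qed (simp add: sum_nonneg)

text \<open>Random coding: the error is averaged over all codebooks, and some codebook does no worse
  than the average. Patterns with fewer than \<open>k\<close> survivors are charged as errors
  outright; for the others the union bound costs at most \<open>M - 1\<close> collisions of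
  probability \<open>1 / CARD('x) ^ k\<close>. The distribution \<open>w\<close> is arbitrary, so
  dependent erasures are allowed.\<close>

lemma exists_codebook:
  fixes w :: "nat set \<Rightarrow> real"
  assumes w: "\<And>E. E \<in> Pow {..<n} \<Longrightarrow> 0 \<le> w E" "(\<Sum>E\<in>Pow {..<n}. w E) = 1" and "0 < M"
  shows "\<exists>f :: nat \<Rightarrow> nat \<Rightarrow> 'x::finite. f \<in> {..<M} \<rightarrow> ({..<n} \<rightarrow>\<^sub>E UNIV) \<and>
    (\<Sum>m<M. \<Sum>E\<in>Pow {..<n}. w E * of_bool (first_compatible n M f (received n E (f m)) \<noteq> m)) / M
    \<le> (\<Sum>E\<in>{E\<in>Pow {..<n}. card E < k}. w E) + (real M - 1) / real CARD('x) ^ k"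
proof -
  define Cb :: "(nat \<Rightarrow> nat \<Rightarrow> 'x) set" where "Cb = {..<M} \<rightarrow>\<^sub>E ({..<n} \<rightarrow>\<^sub>E UNIV)"
  let ?c = "real CARD('x)"
  let ?lo = "{E\<in>Pow {..<n}. card E < k}"
  define b where "b = (\<Sum>E\<in>?lo. w E) + (real M - 1) / ?c ^ k"
  let ?err = "\<lambda>f. \<Sum>m<M. \<Sum>E\<in>Pow {..<n}. w E * of_bool (first_compatible n M f (received n E (f m)) \<noteq> m)"
  have finCb: "finite Cb" and neCb: "Cb \<noteq> {}"
    by (auto simp: Cb_def finite_PiE PiE_eq_empty_iff)
  have c1: "1 \<le> ?c" by (simp add: Suc_leI)
  have avg: "(\<Sum>f\<in>Cb. w E * of_bool (first_compatible n M f (received n E (f m)) \<noteq> m))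
      \<le> w E * (of_bool (card E < k) + (real M - 1) / ?c ^ k) * card Cb"
    if m: "m < M" and E: "E \<in> Pow {..<n}" for m E
  proof (cases "card E < k")
    case True
    have "(\<Sum>f\<in>Cb. w E * of_bool (first_compatible n M f (received n E (f m)) \<noteq> m)) \<le> (\<Sum>f\<in>Cb. w E)"
      using w(1)[OF E] by (intro sum_mono) auto
    also have "\<dots> \<le> w E * (1 + (real M - 1) / ?c ^ k) * card Cb"
    proof -
      have "0 \<le> w E * card Cb * ((real M - 1) / ?c ^ k)"
        using w(1)[OF E] \<open>0 < M\<close> by (intro mult_nonneg_nonneg divide_nonneg_nonneg) auto
      then show ?thesis by (simp add: algebra_simps)
    qed
    finally show ?thesis using True by simp
  next
    case False
    have "(\<Sum>f\<in>Cb. of_bool (first_compatible n M f (received n E (f m)) \<noteq> m))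
       \<le> (\<Sum>f\<in>Cb. \<Sum>m'\<in>{..<M} - {m}. of_bool (\<forall>j\<in>E. f m' j = f m j) :: real)"
      using E m by (intro sum_mono first_compatible_error) auto
    also have "\<dots> = (\<Sum>m'\<in>{..<M} - {m}. \<Sum>f\<in>Cb. of_bool (\<forall>j\<in>E. f m' j = f m j))"
      by (rule sum.swap)
    also have "\<dots> = (\<Sum>m'\<in>{..<M} - {m}. card Cb / ?c ^ card E)"
    proof (intro sum.cong refl)
      fix m' assume "m' \<in> {..<M} - {m}"
      then show "(\<Sum>f\<in>Cb. of_bool (\<forall>j\<in>E. f m' j = f m j)) = card Cb / ?c ^ card E"
        using card_codebooks_agreeing[where 'x='x, of "{..<M}" m m' E n] m E
        by (simp add: Cb_def[symmetric] field_simps)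
    qed
    also have "\<dots> = (real M - 1) * (card Cb / ?c ^ card E)"
      using m by (simp add: of_nat_diff)
    also have "\<dots> \<le> (real M - 1) * (card Cb / ?c ^ k)"
      using False c1 \<open>0 < M\<close> by (intro mult_left_mono divide_left_mono power_increasing) auto
    finally have "(\<Sum>f\<in>Cb. of_bool (first_compatible n M f (received n E (f m)) \<noteq> m)) \<le> (real M - 1) * (card Cb / ?c ^ k)" .
    from mult_left_mono[OF this w(1)[OF E]] show ?thesis
      using False by (simp add: sum_distrib_left mult_ac)
  qed
  have "(\<Sum>f\<in>Cb. ?err f) = (\<Sum>m<M. \<Sum>f\<in>Cb. \<Sum>E\<in>Pow {..<n}. w E * of_bool (first_compatible n M f (received n E (f m)) \<noteq> m))"
    by (rule sum.swap)
  also have "\<dots> = (\<Sum>m<M. \<Sum>E\<in>Pow {..<n}. \<Sum>f\<in>Cb. w E * of_bool (first_compatible n M f (received n E (f m)) \<noteq> m))"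
    by (intro sum.cong refl sum.swap)
  also have "\<dots> \<le> (\<Sum>m<M. \<Sum>E\<in>Pow {..<n}. w E * (of_bool (card E < k) + (real M - 1) / ?c ^ k) * card Cb)"
    using avg by (intro sum_mono) auto
  also have "\<dots> = real M * (card Cb * (\<Sum>E\<in>Pow {..<n}. w E * of_bool (card E < k) + w E * ((real M - 1) / ?c ^ k)))"
    by (simp add: sum_distrib_left algebra_simps)
  also have "(\<Sum>E\<in>Pow {..<n}. w E * of_bool (card E < k) + w E * ((real M - 1) / ?c ^ k)) = b"
  proof -
    have "(\<Sum>E\<in>Pow {..<n}. w E * of_bool (card E < k)) = (\<Sum>E\<in>?lo. w E)"
      by (intro sum.mono_neutral_cong_right) auto
    then show ?thesis unfolding b_def sum.distrib sum_distrib_right[symmetric] w(2) by simp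
  qed
  finally have tot: "(\<Sum>f\<in>Cb. ?err f) \<le> (\<Sum>f\<in>Cb. real M * b)" by (simp add: mult.left_commute)
  have "\<exists>f\<in>Cb. ?err f \<le> real M * b"
  proof (rule ccontr)
    assume "\<not> ?thesis"
    then have "(\<Sum>f\<in>Cb. real M * b) < (\<Sum>f\<in>Cb. ?err f)"
      using finCb neCb by (intro sum_strict_mono) auto
    with tot show False by simp
  qed
  then obtain f where "f \<in> Cb" "?err f \<le> real M * b" by blast
  moreover from this have "?err f / M \<le> b" using \<open>0 < M\<close> by (simp add: field_simps)
  ultimately show ?thesis unfolding b_def Cb_def by (intro exI[of _ f]) auto
qed

section \<open>The M/G/1 waiting times\<close>

definition laplace :: "real measure \<Rightarrow> real \<Rightarrow> real" where
  "laplace M s = (\<integral>x. exp (- s * x) \<partial>M)"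

lemma prob_space_exponential: "0 < l \<Longrightarrow> prob_space (exponential l)"
  unfolding exponential_def by (rule prob_space_exponential_density)

lemma sets_exponential [simp, measurable_cong]: "sets (exponential l) = sets borel"
  by (simp add: exponential_def)

lemma space_exponential [simp]: "space (exponential l) = UNIV"
  by (simp add: exponential_def)

lemma AE_exponential_nonneg: "0 < l \<Longrightarrow> AE t in exponential l. 0 \<le> t"
  unfolding exponential_def by (subst AE_density) (auto simp: exponential_density_def)

lemma has_bochner_integral_exponential:
  assumes "0 < l"
  shows "has_bochner_integral (exponential l) (\<lambda>t. t) (1 / l)"
proof -
  interpret prob_space "exponential l" by (rule prob_space_exponential[OF assms])
  have "distributed (exponential l) lborel (\<lambda>t. t) (exponential_density l)"
    unfolding distributed_def by (auto simp: exponential_def distr_id2)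
  from has_bochner_integral_erlang_ith_moment[OF assms this, of 1] show ?thesis by simp
qed

section \<open>Closed forms for one exponential interarrival time\<close>

lemma integral_exponential_Icc:
  fixes G F :: "real \<Rightarrow> real"
  assumes "0 < l" "0 \<le> v" and G: "\<And>t. isCont G t"
    and F: "\<And>t. DERIV F t :> l * exp (- (l * t)) * G t"
  shows "(\<integral>t. G t * indicator {0..v} t \<partial>exponential l) = F v - F 0"
proof -
  have [measurable]: "G \<in> borel_measurable borel"
    using G by (intro borel_measurable_continuous_onI continuous_at_imp_continuous_on) auto
  have "(\<integral>t. G t * indicator {0..v} t \<partial>exponential l) =
      (\<integral>t. exponential_density l t * (G t * indicator {0..v} t) \<partial>lborel)"
    unfolding exponential_def using assms(1) by (subst integral_real_density) auto
  also have "\<dots> = (\<integral>t. (l * exp (- (l * t)) * G t) * indicator {0..v} t \<partial>lborel)"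
    by (intro Bochner_Integration.integral_cong refl)
      (auto simp: exponential_density_def indicator_def mult.commute)
  also have "\<dots> = F v - F 0"
    using assms by (intro integral_FTC_Icc_real) (auto intro!: continuous_intros)
  finally show ?thesis .
qed

text \<open>Multiplying by \<open>k - l\<close> avoids a division and keeps the identity true at
  \<open>k = l\<close>, where both sides vanish. The right-hand side is again a combination of
  exponentials in \<open>v\<close>, which is what closes the recursion for the waiting-time
  transform.\<close>

lemma exponential_integral_exp_max:
  fixes k l v :: real
  assumes l: "0 < l" and v: "0 \<le> v"
  shows "(k - l) * (\<integral>t. exp (- k * max (v - t) 0) \<partial>exponential l) =
    k * exp (- l * v) - l * exp (- k * v)"
proof (cases "k = l")
  case False
  interpret prob_space "exponential l" by (rule prob_space_exponential[OF l])
  \<comment> \<open>The integrand is \<open>1 - G t\<close> on \<open>{0..v}\<close> and 1 beyond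
    it, so only a compact interval has to be integrated; \<open>F\<close> below is the
    antiderivative of \<open>G\<close> times the density.\<close>
  define G where "G t = 1 - exp (- k * (v - t))" for t
  define d where "d = k - l"
  have d: "d \<noteq> 0" using False by (simp add: d_def)
  define F where "F t = - exp (- l * t) - l * exp (- k * v) * exp (d * t) / d" for t
  have [measurable]: "G \<in> borel_measurable borel" unfolding G_def by measurable
  have "DERIV F t :> l * exp (- (l * t)) * G t" for t
  proof -
    have "DERIV F t :> l * exp (- l * t) - l * exp (- k * v) * exp (d * t)"
      unfolding F_def using d by (auto intro!: derivative_eq_intros simp: field_simps)
    moreover have "exp (- k * v) * exp (d * t) = exp (- (l * t)) * exp (- k * (v - t))"
      by (simp add: exp_add[symmetric] algebra_simps d_def)
    ultimately show ?thesis by (simp add: G_def algebra_simps)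
  qed
  moreover have "isCont G t" for t unfolding G_def by (intro continuous_intros)
  ultimately have I: "(\<integral>t. G t * indicator {0..v} t \<partial>exponential l) = F v - F 0"
    by (intro integral_exponential_Icc[OF l v])
  have int: "integrable (exponential l) (\<lambda>t. G t * indicator {0..v} t)"
  proof (rule integrable_const_bound[of _ "1 + exp (\<bar>k\<bar> * v)"])
    have "\<bar>G t * indicator {0..v} t\<bar> \<le> 1 + exp (\<bar>k\<bar> * v)" for t
    proof (cases "t \<in> {0..v}")
      case True
      have "- k * (v - t) \<le> \<bar>k\<bar> * (v - t)" using True by (intro mult_right_mono) auto
      also have "\<dots> \<le> \<bar>k\<bar> * v" using True by (intro mult_left_mono) auto
      finally have "exp (- k * (v - t)) \<le> exp (\<bar>k\<bar> * v)" by (simp only: exp_le_cancel_iff)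
      moreover have "\<bar>G t\<bar> \<le> 1 + exp (- k * (v - t))" unfolding G_def by (simp add: abs_le_iff)
      ultimately have "\<bar>G t\<bar> \<le> 1 + exp (\<bar>k\<bar> * v)" by linarith
      then show ?thesis using True by simp
    qed (simp add: add_nonneg_nonneg)
    then show "AE t in exponential l. norm (G t * indicator {0..v} t) \<le> 1 + exp (\<bar>k\<bar> * v)" by simp
  qed simp
  have "(\<integral>t. exp (- k * max (v - t) 0) \<partial>exponential l) = (\<integral>t. 1 - G t * indicator {0..v} t \<partial>exponential l)"
    by (rule integral_cong_AE)
      (use AE_exponential_nonneg[OF l] in \<open>auto simp: G_def indicator_def max_def elim!: eventually_mono\<close>)
  also have "\<dots> = 1 - (F v - F 0)"
    using int by (subst Bochner_Integration.integral_diff) (auto simp: I prob_space[simplified])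
  finally have "(\<integral>t. exp (- k * max (v - t) 0) \<partial>exponential l) = 1 - (F v - F 0)" .
  moreover have "exp (- k * v) * exp (d * v) = exp (- l * v)"
    by (simp add: exp_add[symmetric] algebra_simps d_def)
  then have "F v - F 0 = 1 - exp (- l * v) - l * (exp (- l * v) - exp (- k * v)) / d"
    by (simp add: F_def mult.assoc diff_divide_distrib right_diff_distrib)
  then have "d * (1 - (F v - F 0)) = (d + l) * exp (- l * v) - l * exp (- k * v)"
    using d by (simp add: field_simps)
  then have "(k - l) * (1 - (F v - F 0)) = k * exp (- l * v) - l * exp (- k * v)"
    by (simp add: d_def)
  ultimately show ?thesis by simp
qed simp

text \<open>The mean of \<open>v - t\<close>, plus the mean idle time: by lack of memory the latter
  is \<open>1 / l\<close> times the probability \<open>exp (- l * v)\<close> that \<open>t\<close>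
  exceeds \<open>v\<close>.\<close>

lemma exponential_integral_max:
  fixes l v :: real
  assumes l: "0 < l" and v: "0 \<le> v"
  shows "(\<integral>t. max (v - t) 0 \<partial>exponential l) = v - 1 / l + exp (- l * v) / l"
proof -
  define F where "F t = - (v - t) * exp (- l * t) + exp (- l * t) / l" for t
  have "DERIV F t :> l * exp (- (l * t)) * (v - t)" for t
    unfolding F_def using l by (auto intro!: derivative_eq_intros simp: field_simps)
  then have I: "(\<integral>t. (v - t) * indicator {0..v} t \<partial>exponential l) = F v - F 0"
    by (intro integral_exponential_Icc[OF l v]) (auto intro!: continuous_intros)
  have "(\<integral>t. max (v - t) 0 \<partial>exponential l) = (\<integral>t. (v - t) * indicator {0..v} t \<partial>exponential l)"
    by (rule integral_cong_AE)
      (use AE_exponential_nonneg[OF l] in \<open>auto simp: indicator_def max_def elim!: eventually_mono\<close>)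
  also have "\<dots> = v - 1 / l + exp (- l * v) / l" unfolding I by (simp add: F_def)
  finally show ?thesis .
qed

section \<open>Lindley's recursion and gluing of timings\<close>

text \<open>The waiting-time recursion re-indexed so that step \<open>j\<close> uses the
  interarrival and the service time of the same index. Both sequences can then be cut at a common
  index; the time before the first arrival has been dropped.\<close>

primrec lindley :: "(nat \<Rightarrow> real) \<times> (nat \<Rightarrow> real) \<Rightarrow> nat \<Rightarrow> real" where
  "lindley \<omega> 0 = 0"
| "lindley \<omega> (Suc j) = max (lindley \<omega> j + snd \<omega> j - fst \<omega> j) 0"

lemma waiting_eq_lindley: "waiting \<omega> j = lindley (\<lambda>i. fst \<omega> (Suc i), snd \<omega>) j"
  by (induction j) (simp_all add: arrival_def)

lemma lindley_nonneg: "0 \<le> lindley \<omega> j"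
  by (cases j) simp_all

lemma lindley_le_sum: "lindley \<omega> j \<le> (\<Sum>i<j. \<bar>snd \<omega> i\<bar>) + (\<Sum>i<j. \<bar>fst \<omega> i\<bar>)"
  by (induction j) auto

text \<open>The first \<open>i\<close> entries come from \<open>\<omega>\<close>, all later ones
  from \<open>\<omega>'\<close>. With two independent timings the result is again a timing
  (\<open>distr_restart\<close>), so integrating over \<open>\<omega>'\<close> alone conditions on
  the first \<open>i\<close> steps.\<close>

definition restart where
  "restart i \<omega> \<omega>' = (comb_seq i (fst \<omega>) (fst \<omega>'), comb_seq i (snd \<omega>) (snd \<omega>'))"

lemma lindley_restart: "j \<le> i \<Longrightarrow> lindley (restart i \<omega> \<omega>') j = lindley \<omega> j"
  by (induction j) (simp_all add: restart_def comb_seq_less)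

lemma lindley_restart_Suc:
  "lindley (restart i \<omega> \<omega>') (Suc i) = max (lindley \<omega> i + snd \<omega>' 0 - fst \<omega>' 0) 0"
  using comb_seq_add[of i "fst \<omega>" "fst \<omega>'" 0] comb_seq_add[of i "snd \<omega>" "snd \<omega>'" 0]
    lindley_restart[of i i \<omega> \<omega>'] by (simp add: restart_def)

text \<open>The recursion is monotone in the current wait, and the glued queue enters step
  \<open>i\<close> with a nonnegative wait where the fresh queue has 0.\<close>

lemma lindley_restart_ge: "lindley \<omega>' k \<le> lindley (restart i \<omega> \<omega>') (i + k)"
proof (induction k)
  case (Suc k)
  have "snd (restart i \<omega> \<omega>') (i + k) = snd \<omega>' k" "fst (restart i \<omega> \<omega>') (i + k) = fst \<omega>' k"
    using comb_seq_add[of i "fst \<omega>" "fst \<omega>'" k] comb_seq_add[of i "snd \<omega>" "snd \<omega>'" k]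
    by (simp_all add: restart_def add.commute)
  with Suc show ?case by simp
qed (simp add: lindley_nonneg)

lemma (in sequence_space) nn_integral_comb_seq:
  assumes [measurable]: "f \<in> borel_measurable S"
  shows "(\<integral>\<^sup>+\<omega>. \<integral>\<^sup>+\<omega>'. f (comb_seq i \<omega> \<omega>') \<partial>S \<partial>S) = (\<integral>\<^sup>+\<omega>. f \<omega> \<partial>S)"
proof -
  have "(\<integral>\<^sup>+\<omega>. f \<omega> \<partial>S) = (\<integral>\<^sup>+x. f ((\<lambda>(\<omega>, \<omega>'). comb_seq i \<omega> \<omega>') x) \<partial>(S \<Otimes>\<^sub>M S))"
    by (subst nn_integral_distr[OF measurable_comb_seq, symmetric]) (simp_all add: PiM_comb_seq)
  also have "\<dots> = (\<integral>\<^sup>+\<omega>. \<integral>\<^sup>+\<omega>'. f (comb_seq i \<omega> \<omega>') \<partial>S \<partial>S)"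
    by (subst P.nn_integral_fst[symmetric]) simp_all
  finally show ?thesis ..
qed

lemma (in pair_prob_space) distr_pair_snd: "distr (M1 \<Otimes>\<^sub>M M2) M2 snd = M2"
proof (rule measure_eqI)
  fix A assume "A \<in> sets (distr (M1 \<Otimes>\<^sub>M M2) M2 snd)"
  then have A: "A \<in> sets M2" by simp
  then have "snd -` A \<inter> space (M1 \<Otimes>\<^sub>M M2) = space M1 \<times> A"
    using sets.sets_into_space by (auto simp: space_pair_measure)
  with A show "emeasure (distr (M1 \<Otimes>\<^sub>M M2) M2 snd) A = emeasure M2 A"
    by (simp add: emeasure_distr M2.emeasure_pair_measure_Times M1.emeasure_space_1)
qed simp

lemma exp_mult_add: "exp (- (a * (b + c))) = exp (- (a * b)) * exp (- (a * c))" for a b c :: real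
  by (simp add: exp_add[symmetric] distrib_left)

lemma has_bochner_integral_distrD:
  fixes f :: "'a \<Rightarrow> real"
  assumes "g \<in> measurable M N" "f \<in> borel_measurable N" "has_bochner_integral (distr M N g) f x"
  shows "has_bochner_integral M (\<lambda>x. f (g x)) x"
  using assms(3) integrable_distr_eq[OF assms(1,2)] integral_distr[OF assms(1,2)]
  by (simp add: has_bochner_integral_iff)

section \<open>The stable queue with Poisson arrivals and the law of its timing\<close>

locale poisson_queue =
  fixes lam :: real and FS :: "real measure"
  assumes lam_pos: "0 < lam" and lam_less_1: "lam < 1" and service: "unit_mean_service FS"
begin

abbreviation "FA \<equiv> exponential lam"
abbreviation "N \<equiv> \<Pi>\<^sub>M j\<in>(UNIV :: nat set). FA"
abbreviation "Q \<equiv> \<Pi>\<^sub>M j\<in>(UNIV :: nat set). FS"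
abbreviation "P \<equiv> timing FA FS"

sublocale FA: prob_space FA by (rule prob_space_exponential[OF lam_pos])
sublocale FS: real_distribution FS using service by (simp add: unit_mean_service_def)
sublocale N: sequence_space FA by unfold_locales
sublocale Q: sequence_space FS by unfold_locales
sublocale NQ: pair_prob_space N Q by unfold_locales
sublocale AS: pair_prob_space FA FS by unfold_locales

lemma P_eq: "P = N \<Otimes>\<^sub>M Q" by (simp add: timing_def)

sublocale P: prob_space P unfolding P_eq by unfold_locales
sublocale PP: pair_prob_space P P by unfold_locales

lemma sets_P [measurable_cong]:
  "sets P = sets ((\<Pi>\<^sub>M j\<in>UNIV. borel) \<Otimes>\<^sub>M (\<Pi>\<^sub>M j\<in>UNIV. borel))"
  unfolding P_eq by (intro sets_pair_measure_cong sets_PiM_cong) simp_all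

lemma measurable_component_P [measurable (raw)]:
  assumes "f \<in> measurable M P"
  shows "(\<lambda>x. fst (f x) i) \<in> borel_measurable M" "(\<lambda>x. snd (f x) i) \<in> borel_measurable M"
proof -
  let ?B = "\<Pi>\<^sub>M j\<in>(UNIV :: nat set). borel :: real measure"
  have f: "f \<in> measurable M (?B \<Otimes>\<^sub>M ?B)"
    using assms by (simp add: measurable_cong_sets[OF refl sets_P])
  show "(\<lambda>x. fst (f x) i) \<in> borel_measurable M" "(\<lambda>x. snd (f x) i) \<in> borel_measurable M"
    using measurable_compose[OF measurable_compose[OF f measurable_fst] measurable_component_singleton[of i UNIV]]
      measurable_compose[OF measurable_compose[OF f measurable_snd] measurable_component_singleton[of i UNIV]]
    by simp_all
qed

lemma measurable_P_I [measurable (raw)]: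
  assumes "\<And>i. (\<lambda>x. f x i) \<in> borel_measurable M" "\<And>i. (\<lambda>x. g x i) \<in> borel_measurable M"
  shows "(\<lambda>x. (f x, g x)) \<in> measurable M P"
  unfolding measurable_cong_sets[OF refl sets_P]
  using assms by (intro measurable_Pair measurable_abs_UNIV)

lemma measurable_lindley [measurable (raw)]:
  assumes [measurable]: "f \<in> measurable M P"
  shows "(\<lambda>x. lindley (f x) j) \<in> borel_measurable M"
  by (induction j) simp_all

lemma borel_measurable_lindley [measurable]: "(\<lambda>\<omega>. lindley \<omega> j) \<in> borel_measurable P"
  by (rule measurable_lindley) simp

lemma measurable_waiting [measurable (raw)]:
  assumes [measurable]: "f \<in> measurable M P"
  shows "(\<lambda>x. waiting (f x) j) \<in> borel_measurable M"
  by (induction j) (simp_all add: arrival_def)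

lemma measurable_restart [measurable (raw)]:
  assumes [measurable]: "f \<in> measurable M P" "g \<in> measurable M P"
  shows "(\<lambda>x. restart i (f x) (g x)) \<in> measurable M P"
  unfolding restart_def comb_seq_def by measurable

text \<open>Fubini brings the two interarrival sequences next to each other and likewise the two
  service sequences; each pair is then merged by the gluing property of an i.i.d. sequence.\<close>

lemma distr_restart: "distr (P \<Otimes>\<^sub>M P) P (\<lambda>(\<omega>, \<omega>'). restart i \<omega> \<omega>') = P"
proof (rule measure_eqI)
  fix A assume "A \<in> sets (distr (P \<Otimes>\<^sub>M P) P (\<lambda>(\<omega>, \<omega>'). restart i \<omega> \<omega>'))"
  then have A: "A \<in> sets P" by simp
  then have [measurable]: "A \<in> sets (N \<Otimes>\<^sub>M Q)" by (simp add: P_eq)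
  let ?I = "indicator A :: _ \<Rightarrow> ennreal"
  have "emeasure (distr (P \<Otimes>\<^sub>M P) P (\<lambda>(\<omega>, \<omega>'). restart i \<omega> \<omega>')) A =
      (\<integral>\<^sup>+x. ?I ((\<lambda>(\<omega>, \<omega>'). restart i \<omega> \<omega>') x) \<partial>(P \<Otimes>\<^sub>M P))"
    using A by (subst nn_integral_distr[symmetric, of _ _ P]) auto
  also have "\<dots> = (\<integral>\<^sup>+\<omega>. \<integral>\<^sup>+\<omega>'. ?I (restart i \<omega> \<omega>') \<partial>P \<partial>P)"
    using A by (subst P.nn_integral_fst[symmetric]) auto
  also have "\<dots> = (\<integral>\<^sup>+\<omega>. \<integral>\<^sup>+t'. \<integral>\<^sup>+s'. ?I (restart i \<omega> (t', s')) \<partial>Q \<partial>N \<partial>P)"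
    unfolding P_eq restart_def
    by (intro nn_integral_cong, subst Q.P.nn_integral_fst[symmetric]) auto
  also have "\<dots> = (\<integral>\<^sup>+t. \<integral>\<^sup>+s. \<integral>\<^sup>+t'. \<integral>\<^sup>+s'. ?I (comb_seq i t t', comb_seq i s s') \<partial>Q \<partial>N \<partial>Q \<partial>N)"
    unfolding P_eq restart_def by (subst Q.P.nn_integral_fst[symmetric]) auto
  also have "\<dots> = (\<integral>\<^sup>+t. \<integral>\<^sup>+t'. \<integral>\<^sup>+s. \<integral>\<^sup>+s'. ?I (comb_seq i t t', comb_seq i s s') \<partial>Q \<partial>Q \<partial>N \<partial>N)"
    by (intro nn_integral_cong NQ.Fubini') simp
  also have "\<dots> = (\<integral>\<^sup>+t. \<integral>\<^sup>+t'. \<integral>\<^sup>+s. ?I (comb_seq i t t', s) \<partial>Q \<partial>N \<partial>N)"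
    by (intro nn_integral_cong Q.nn_integral_comb_seq[of "\<lambda>s. ?I (_, s)"]) simp
  also have "\<dots> = (\<integral>\<^sup>+t. \<integral>\<^sup>+s. ?I (t, s) \<partial>Q \<partial>N)"
    by (intro N.nn_integral_comb_seq[of "\<lambda>t. \<integral>\<^sup>+s. ?I (t, s) \<partial>Q"]) simp
  also have "\<dots> = emeasure P A"
    unfolding P_eq by (subst Q.P.nn_integral_fst) auto
  finally show "emeasure (distr (P \<Otimes>\<^sub>M P) P (\<lambda>(\<omega>, \<omega>'). restart i \<omega> \<omega>')) A = emeasure P A" .
qed simp

lemma integral_restart:
  fixes F :: "_ \<Rightarrow> real"
  assumes "integrable P F"
  shows "(\<integral>\<omega>. F \<omega> \<partial>P) = (\<integral>\<omega>. \<integral>\<omega>'. F (restart i \<omega> \<omega>') \<partial>P \<partial>P)"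
    and "integrable P (\<lambda>\<omega>. \<integral>\<omega>'. F (restart i \<omega> \<omega>') \<partial>P)"
proof -
  let ?f = "\<lambda>(\<omega>, \<omega>'). restart i \<omega> \<omega>'"
  have [measurable]: "F \<in> borel_measurable P" using assms by auto
  have int: "integrable (P \<Otimes>\<^sub>M P) (\<lambda>x. F (?f x))"
    by (subst integrable_distr_eq[symmetric, of _ _ P]) (auto simp: distr_restart assms)
  have "(\<integral>\<omega>. F \<omega> \<partial>P) = (\<integral>\<omega>. F \<omega> \<partial>distr (P \<Otimes>\<^sub>M P) P ?f)" by (simp add: distr_restart)
  also have "\<dots> = (\<integral>x. F (?f x) \<partial>(P \<Otimes>\<^sub>M P))" by (rule integral_distr) auto
  also have "\<dots> = (\<integral>\<omega>. \<integral>\<omega>'. F (restart i \<omega> \<omega>') \<partial>P \<partial>P)"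
    using PP.integral_fst'[OF int] by simp
  finally show "(\<integral>\<omega>. F \<omega> \<partial>P) = (\<integral>\<omega>. \<integral>\<omega>'. F (restart i \<omega> \<omega>') \<partial>P \<partial>P)" .
  show "integrable P (\<lambda>\<omega>. \<integral>\<omega>'. F (restart i \<omega> \<omega>') \<partial>P)"
    using PP.integrable_fst'[OF int] by simp
qed

lemma measurable_shift [measurable]:
  "(\<lambda>\<omega>. (\<lambda>i. fst \<omega> (Suc i), snd \<omega>)) \<in> measurable P P"
  by measurable

text \<open>Dropping the first interarrival time preserves the i.i.d. law, so expectations of
  \<open>waiting\<close> and of \<open>lindley\<close> coincide.\<close>

lemma distr_shift: "distr P P (\<lambda>\<omega>. (\<lambda>i. fst \<omega> (Suc i), snd \<omega>)) = P"
proof -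
  have "distr N N (\<lambda>\<omega>. \<lambda>i. \<omega> (Suc i)) = N"
    using distr_PiM_reindex[of UNIV "\<lambda>_. FA" Suc UNIV] FA.prob_space_axioms by (simp add: restrict_def)
  moreover have shift: "(\<lambda>\<omega>. \<lambda>i. \<omega> (Suc i)) \<in> measurable N N"
    by (intro measurable_abs_UNIV measurable_component_singleton) simp
  moreover have "distr N N (\<lambda>\<omega>. \<lambda>i. \<omega> (Suc i)) \<Otimes>\<^sub>M distr Q Q (\<lambda>s. s) =
      distr (N \<Otimes>\<^sub>M Q) (N \<Otimes>\<^sub>M Q) (\<lambda>(t, s). (\<lambda>i. t (Suc i), s))"
    by (rule pair_measure_distr[OF shift]) (simp_all add: distr_id2 Q.P.sigma_finite_measure_axioms)
  ultimately show ?thesis by (simp add: P_eq distr_id2 split_beta')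
qed

lemma integral_shift:
  fixes F :: "_ \<Rightarrow> real"
  assumes "F \<in> borel_measurable P"
  shows "(\<integral>\<omega>. F (\<lambda>i. fst \<omega> (Suc i), snd \<omega>) \<partial>P) = (\<integral>\<omega>. F \<omega> \<partial>P)"
  using integral_distr[OF measurable_shift assms] by (simp add: distr_shift)

lemma distr_step: "distr P (FA \<Otimes>\<^sub>M FS) (\<lambda>\<omega>. (fst \<omega> j, snd \<omega> j)) = FA \<Otimes>\<^sub>M FS"
proof -
  have "distr N FA (\<lambda>t. t j) = FA" "distr Q FS (\<lambda>s. s j) = FS"
    by (simp_all add: N.PiM_component Q.PiM_component)
  moreover have "distr N FA (\<lambda>t. t j) \<Otimes>\<^sub>M distr Q FS (\<lambda>s. s j) =
      distr (N \<Otimes>\<^sub>M Q) (FA \<Otimes>\<^sub>M FS) (\<lambda>(t, s). (t j, s j))"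
    by (rule pair_measure_distr) (auto simp: Q.PiM_component FS.sigma_finite_measure_axioms)
  ultimately show ?thesis by (simp add: P_eq split_beta')
qed

text \<open>The interarrival time is integrated innermost, since that is the integral known in
  closed form.\<close>

lemma integral_step:
  fixes F :: "_ \<Rightarrow> real"
  assumes "integrable (FA \<Otimes>\<^sub>M FS) F"
  shows "(\<integral>\<omega>. F (fst \<omega> j, snd \<omega> j) \<partial>P) = (\<integral>s. \<integral>t. F (t, s) \<partial>FA \<partial>FS)"
proof -
  have [measurable]: "F \<in> borel_measurable (FA \<Otimes>\<^sub>M FS)" using assms by auto
  have "(\<integral>\<omega>. F (fst \<omega> j, snd \<omega> j) \<partial>P) = (\<integral>x. F x \<partial>distr P (FA \<Otimes>\<^sub>M FS) (\<lambda>\<omega>. (fst \<omega> j, snd \<omega> j)))"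
    by (rule integral_distr[symmetric]) (auto simp: P_eq)
  also have "\<dots> = (\<integral>s. \<integral>t. F (t, s) \<partial>FA \<partial>FS)"
    unfolding distr_step using AS.integral_snd[of "\<lambda>t s. F (t, s)"] assms by simp
  finally show ?thesis .
qed

lemma distr_fst_component: "distr P FA (\<lambda>\<omega>. fst \<omega> j) = FA"
proof -
  have "distr (distr P (FA \<Otimes>\<^sub>M FS) (\<lambda>\<omega>. (fst \<omega> j, snd \<omega> j))) FA fst = distr P FA (\<lambda>\<omega>. fst \<omega> j)"
    by (subst distr_distr) (auto simp: comp_def)
  then show ?thesis by (simp add: distr_step FS.distr_pair_fst)
qed

lemma distr_snd_component: "distr P FS (\<lambda>\<omega>. snd \<omega> j) = FS"
proof -
  have "distr (distr P (FA \<Otimes>\<^sub>M FS) (\<lambda>\<omega>. (fst \<omega> j, snd \<omega> j))) FS snd = distr P FS (\<lambda>\<omega>. snd \<omega> j)"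
    by (subst distr_distr) (auto simp: comp_def)
  then show ?thesis by (simp add: distr_step AS.distr_pair_snd)
qed

lemma measurable_components [measurable]:
  "(\<lambda>\<omega>. fst \<omega> j) \<in> measurable P FA" "(\<lambda>\<omega>. snd \<omega> j) \<in> measurable P FS"
  by measurable

lemma has_bochner_integral_fst: "has_bochner_integral P (\<lambda>\<omega>. fst \<omega> j) (1 / lam)"
  by (rule has_bochner_integral_distrD[OF measurable_components(1)])
    (simp_all add: distr_fst_component has_bochner_integral_exponential[OF lam_pos])

lemma integral_FS: "integrable FS (\<lambda>x. x)" "(\<integral>x. x \<partial>FS) = 1"
  using service by (auto simp: unit_mean_service_def)

lemma AE_service_pos: "AE s in FS. 0 < s"
proof -
  have "measure FS {..0} = 0" using service by (simp add: unit_mean_service_def cdf_def)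
  then have "emeasure FS {..0} = 0" by (simp add: FS.emeasure_eq_measure)
  then have "AE s in FS. s \<notin> {..0}" by (intro AE_not_in) (auto simp: null_sets_def)
  then show ?thesis by eventually_elim auto
qed

lemma has_bochner_integral_snd: "has_bochner_integral P (\<lambda>\<omega>. snd \<omega> j) 1"
  by (rule has_bochner_integral_distrD[OF measurable_components(2)])
    (simp_all add: distr_snd_component has_bochner_integral_iff integral_FS)

lemma AE_snd_pos: "AE \<omega> in P. \<forall>j. 0 < snd \<omega> j"
proof (subst AE_all_countable, rule allI)
  fix j
  have "(\<lambda>\<omega>. snd \<omega> j) \<in> measurable P FS" by measurable
  then show "AE \<omega> in P. 0 < snd \<omega> j"
    by (rule AE_distrD) (simp only: distr_snd_component AE_service_pos)
qed

lemma integrable_lindley: "integrable P (\<lambda>\<omega>. lindley \<omega> j)"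
proof (rule Bochner_Integration.integrable_bound)
  show "integrable P (\<lambda>\<omega>. (\<Sum>i<j. \<bar>snd \<omega> i\<bar>) + (\<Sum>i<j. \<bar>fst \<omega> i\<bar>))"
    using has_bochner_integral_fst has_bochner_integral_snd
    by (auto simp: has_bochner_integral_iff intro!: Bochner_Integration.integrable_add
        Bochner_Integration.integrable_sum integrable_abs)
  show "AE \<omega> in P. norm (lindley \<omega> j) \<le> norm ((\<Sum>i<j. \<bar>snd \<omega> i\<bar>) + (\<Sum>i<j. \<bar>fst \<omega> i\<bar>))"
    using lindley_le_sum[of _ j] lindley_nonneg[of _ j] by (auto intro!: AE_I2 simp: order_trans[OF _ abs_ge_self])
qed simp

section \<open>One-step recursions for the transform and the mean of the wait\<close>

definition phi :: "real \<Rightarrow> nat \<Rightarrow> real" where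
  "phi s j = (\<integral>\<omega>. exp (- s * lindley \<omega> j) \<partial>P)"

definition mean_wait :: "nat \<Rightarrow> real" where
  "mean_wait j = (\<integral>\<omega>. lindley \<omega> j \<partial>P)"

lemma exp_lindley_bounds: "0 \<le> s \<Longrightarrow> 0 \<le> exp (- s * lindley \<omega> j) \<and> exp (- s * lindley \<omega> j) \<le> 1"
  using lindley_nonneg[of \<omega> j] by simp

lemma integrable_exp_lindley: "0 \<le> s \<Longrightarrow> integrable P (\<lambda>\<omega>. exp (- s * lindley \<omega> j))"
proof (rule P.integrable_const_bound[of _ 1])
  assume "0 \<le> s"
  show "AE \<omega> in P. norm (exp (- s * lindley \<omega> j)) \<le> 1"
    using exp_lindley_bounds[OF \<open>0 \<le> s\<close>, of _ j] by (intro AE_I2) simp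
qed measurable

lemma phi_bounds: "0 \<le> s \<Longrightarrow> 0 \<le> phi s j \<and> phi s j \<le> 1"
proof -
  assume s: "0 \<le> s"
  have "phi s j \<le> 1"
    unfolding phi_def using exp_lindley_bounds[OF s, of _ j]
    by (intro P.integral_le_const integrable_exp_lindley[OF s] AE_I2) simp
  then show ?thesis unfolding phi_def by simp
qed

lemma phi_0: "phi s 0 = 1"
  by (simp add: phi_def P.prob_space)

lemma integrable_exp_service: "0 \<le> s \<Longrightarrow> integrable FS (\<lambda>x. exp (- s * x))"
proof (rule FS.integrable_const_bound[of _ 1])
  assume "0 \<le> s"
  then show "AE x in FS. norm (exp (- s * x)) \<le> 1"
    using AE_service_pos by (auto elim!: eventually_mono)
qed measurable

text \<open>Conditioning on the first \<open>j\<close> steps leaves one fresh pair of interarrival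
  and service time. Integrating the former produces \<open>exp (- lam * (w + x))\<close> and
  \<open>exp (- s * (w + x))\<close>, which factor over the past wait \<open>w\<close> and the
  service time \<open>x\<close>.\<close>

lemma phi_Suc:
  assumes s: "0 < s"
  shows "(s - lam) * phi s (Suc j) = s * (laplace FS lam * phi lam j) - lam * (laplace FS s * phi s j)"
proof -
  have inner: "(s - lam) * (\<integral>\<omega>'. exp (- s * lindley (restart j \<omega> \<omega>') (Suc j)) \<partial>P) =
      s * laplace FS lam * exp (- lam * lindley \<omega> j) - lam * laplace FS s * exp (- s * lindley \<omega> j)" for \<omega>
  proof -
    define w where "w = lindley \<omega> j"
    have w: "0 \<le> w" by (simp add: w_def lindley_nonneg)
    let ?F = "\<lambda>(t, x). exp (- s * max (w + x - t) 0)"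
    have "integrable (FA \<Otimes>\<^sub>M FS) ?F"
      using s by (intro AS.integrable_const_bound[of _ 1]) auto
    from integral_step[OF this, of 0]
    have "(\<integral>\<omega>'. exp (- s * lindley (restart j \<omega> \<omega>') (Suc j)) \<partial>P) =
        (\<integral>x. \<integral>t. exp (- s * max (w + x - t) 0) \<partial>FA \<partial>FS)"
      by (simp only: lindley_restart_Suc w_def[symmetric] prod.case)
    then have "(s - lam) * (\<integral>\<omega>'. exp (- s * lindley (restart j \<omega> \<omega>') (Suc j)) \<partial>P) =
        (\<integral>x. (s - lam) * (\<integral>t. exp (- s * max (w + x - t) 0) \<partial>FA) \<partial>FS)"
      by simp
    also have "\<dots> = (\<integral>x. s * exp (- lam * w) * exp (- lam * x) - lam * exp (- s * w) * exp (- s * x) \<partial>FS)"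
    proof (rule integral_cong_AE)
      show "AE x in FS. (s - lam) * (\<integral>t. exp (- s * max (w + x - t) 0) \<partial>FA) =
          s * exp (- lam * w) * exp (- lam * x) - lam * exp (- s * w) * exp (- s * x)"
        using AE_service_pos
      proof eventually_elim
        case (elim x)
        show ?case
          using exponential_integral_exp_max[OF lam_pos, of "w + x" s] w elim
          by (simp add: exp_mult_add mult.assoc)
      qed
    qed measurable
    also have "\<dots> = s * exp (- lam * w) * laplace FS lam - lam * exp (- s * w) * laplace FS s"
      using integrable_exp_service[of lam] integrable_exp_service[of s] s lam_pos
      unfolding laplace_def by simp
    finally show ?thesis by (simp add: w_def mult_ac)
  qed
  have "(s - lam) * phi s (Suc j) =
      (\<integral>\<omega>. (s - lam) * (\<integral>\<omega>'. exp (- s * lindley (restart j \<omega> \<omega>') (Suc j)) \<partial>P) \<partial>P)"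
    unfolding phi_def using integral_restart(1)[OF integrable_exp_lindley[of s "Suc j"], of j] s by simp
  also have "\<dots> = (\<integral>\<omega>. s * laplace FS lam * exp (- lam * lindley \<omega> j) - lam * laplace FS s * exp (- s * lindley \<omega> j) \<partial>P)"
    by (simp only: inner)
  also have "\<dots> = s * (laplace FS lam * phi lam j) - lam * (laplace FS s * phi s j)"
    using integrable_exp_lindley[of s j] integrable_exp_lindley[of lam j] s lam_pos
    by (simp add: phi_def)
  finally show ?thesis .
qed

text \<open>The same conditioning for the first moment. The last summand is the mean idle time
  before the next arrival; 1 and \<open>1 / lam\<close> are the mean service and interarrival
  times.\<close>

lemma mean_wait_Suc:
  "mean_wait (Suc j) = mean_wait j + 1 - 1 / lam + laplace FS lam * phi lam j / lam"
proof -
  have inner: "(\<integral>\<omega>'. lindley (restart j \<omega> \<omega>') (Suc j) \<partial>P) =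
      lindley \<omega> j + (1 - 1 / lam) + laplace FS lam / lam * exp (- lam * lindley \<omega> j)" for \<omega>
  proof -
    define w where "w = lindley \<omega> j"
    have w: "0 \<le> w" by (simp add: w_def lindley_nonneg)
    let ?F = "\<lambda>(t, x). max (w + x - t) 0"
    \<comment> \<open>The integrand is unbounded, so its integrability is derived from the first
      moments and carried over along \<open>distr_step\<close>.\<close>
    have "integrable P (\<lambda>\<omega>'. max (w + snd \<omega>' 0 - fst \<omega>' 0) 0)"
      using has_bochner_integral_fst[of 0] has_bochner_integral_snd[of 0]
      by (auto simp: has_bochner_integral_iff)
    then have "integrable (distr P (FA \<Otimes>\<^sub>M FS) (\<lambda>\<omega>. (fst \<omega> 0, snd \<omega> 0))) ?F"
      by (subst integrable_distr_eq) (auto simp: P_eq)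
    then have "integrable (FA \<Otimes>\<^sub>M FS) ?F" by (simp add: distr_step)
    from integral_step[OF this, of 0]
    have "(\<integral>\<omega>'. lindley (restart j \<omega> \<omega>') (Suc j) \<partial>P) = (\<integral>x. \<integral>t. max (w + x - t) 0 \<partial>FA \<partial>FS)"
      by (simp only: lindley_restart_Suc w_def[symmetric] prod.case)
    also have "\<dots> = (\<integral>x. w + x - 1 / lam + exp (- lam * w) / lam * exp (- lam * x) \<partial>FS)"
    proof (rule integral_cong_AE)
      show "AE x in FS. (\<integral>t. max (w + x - t) 0 \<partial>FA) = w + x - 1 / lam + exp (- lam * w) / lam * exp (- lam * x)"
        using AE_service_pos
      proof eventually_elim
        case (elim x)
        show ?case
          using exponential_integral_max[OF lam_pos, of "w + x"] w elim
          by (simp add: exp_mult_add)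
      qed
    qed measurable
    also have "\<dots> = w + 1 - 1 / lam + exp (- lam * w) / lam * laplace FS lam"
      using integrable_exp_service[of lam] lam_pos integral_FS FS.prob_space
      unfolding laplace_def by simp
    finally show ?thesis by (simp add: w_def)
  qed
  have "mean_wait (Suc j) = (\<integral>\<omega>. \<integral>\<omega>'. lindley (restart j \<omega> \<omega>') (Suc j) \<partial>P \<partial>P)"
    unfolding mean_wait_def by (rule integral_restart(1)[OF integrable_lindley])
  also have "\<dots> = (\<integral>\<omega>. lindley \<omega> j + (1 - 1 / lam) + laplace FS lam / lam * exp (- lam * lindley \<omega> j) \<partial>P)"
    by (simp only: inner)
  also have "\<dots> = mean_wait j + (1 - 1 / lam) + laplace FS lam / lam * phi lam j"
    using integrable_exp_lindley[of lam j] lam_pos integrable_lindley[of j] P.prob_space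
    by (simp add: phi_def mean_wait_def)
  finally show ?thesis by simp
qed

text \<open>Given the first \<open>i\<close> steps, the wait \<open>k\<close> steps later dominates
  that of an independent queue started empty. Replacing it by the latter decouples the two
  factors.\<close>

lemma integral_exp_lindley_pair_le:
  assumes s: "0 \<le> s"
  shows "(\<integral>\<omega>. exp (- s * lindley \<omega> i) * exp (- s * lindley \<omega> (i + k)) \<partial>P) \<le> phi s i * phi s k"
proof -
  let ?F = "\<lambda>\<omega>. exp (- s * lindley \<omega> i) * exp (- s * lindley \<omega> (i + k))"
  have int: "integrable P ?F"
    using exp_lindley_bounds[OF s]
    by (intro P.integrable_const_bound[of _ 1]) (auto intro!: mult_le_one)
  have "(\<integral>\<omega>. ?F \<omega> \<partial>P) = (\<integral>\<omega>. \<integral>\<omega>'. ?F (restart i \<omega> \<omega>') \<partial>P \<partial>P)"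
    by (rule integral_restart(1)[OF int])
  also have "\<dots> \<le> (\<integral>\<omega>. exp (- s * lindley \<omega> i) * phi s k \<partial>P)"
  proof (rule integral_mono)
    show "integrable P (\<lambda>\<omega>. \<integral>\<omega>'. ?F (restart i \<omega> \<omega>') \<partial>P)" by (rule integral_restart(2)[OF int])
    show "integrable P (\<lambda>\<omega>. exp (- s * lindley \<omega> i) * phi s k)"
      using integrable_exp_lindley[OF s, of i] by simp
    fix \<omega>
    have "(\<integral>\<omega>'. ?F (restart i \<omega> \<omega>') \<partial>P) \<le> (\<integral>\<omega>'. exp (- s * lindley \<omega> i) * exp (- s * lindley \<omega>' k) \<partial>P)"
    proof (rule integral_mono')
      show "integrable P (\<lambda>\<omega>'. exp (- s * lindley \<omega> i) * exp (- s * lindley \<omega>' k))"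
        using integrable_exp_lindley[OF s, of k] by simp
      fix \<omega>'
      show "?F (restart i \<omega> \<omega>') \<le> exp (- s * lindley \<omega> i) * exp (- s * lindley \<omega>' k)"
        using lindley_restart_ge[of \<omega>' k i \<omega>] lindley_restart[of i i \<omega> \<omega>'] s
        by (simp add: mult_left_mono)
    qed simp
    then show "(\<integral>\<omega>'. ?F (restart i \<omega> \<omega>') \<partial>P) \<le> exp (- s * lindley \<omega> i) * phi s k"
      by (simp add: phi_def)
  qed
  also have "\<dots> = phi s i * phi s k" by (simp add: phi_def)
  finally show ?thesis .
qed

end

section \<open>Long-run averages\<close>

lemma eventually_div_real_less:
  fixes C e :: real
  assumes "0 < e"
  shows "\<forall>\<^sub>F n in sequentially. C / real n < e"
proof -
  have "(\<lambda>n. C / real n) \<longlonglongrightarrow> 0" by (rule lim_const_over_n)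
  then show ?thesis using assms by (rule order_tendstoD)
qed

text \<open>On the right \<open>a i\<close> occurs for each \<open>m\<close> with
  \<open>i \<le> m < n\<close>, that is \<open>n - i\<close> times.\<close>

lemma sum_weighted_eq_sum_partial_sums:
  fixes a :: "nat \<Rightarrow> real"
  shows "(\<Sum>i<n. a i * real (n - i)) = (\<Sum>m<n. \<Sum>i<Suc m. a i)"
proof (induction n)
  case (Suc n)
  have "(\<Sum>i<Suc n. a i * real (Suc n - i)) = (\<Sum>i<n. a i * real (n - i) + a i) + a n"
    by (auto simp: algebra_simps of_nat_diff Suc_diff_le intro!: sum.cong)
  then show ?case unfolding sum.distrib Suc by simp
qed simp

text \<open>Summation by parts turns an asymptotic bound on the partial sums into one on their convolution.\<close>

lemma convolution_sum_upper:
  fixes a :: "nat \<Rightarrow> real"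
  assumes a: "\<And>j. 0 \<le> a j \<and> a j \<le> 1" and lim: "(\<lambda>n. (\<Sum>j<n. a j) / real n) \<longlonglongrightarrow> r" and "0 \<le> r" "0 < e"
  shows "\<forall>\<^sub>F n in sequentially. 2 * (\<Sum>i<n. a i * (\<Sum>k<n - i. a k)) \<le> (r\<^sup>2 + e) * (real n)\<^sup>2"
proof -
  \<comment> \<open>A slope strictly above \<open>r\<close> leaves the room
    \<open>r\<^sup>2 + e - q\<^sup>2\<close> that later absorbs all terms linear in
    \<open>n\<close>.\<close>
  obtain q where q: "r < q" "q\<^sup>2 < r\<^sup>2 + e"
  proof -
    have "((\<lambda>q. q\<^sup>2) \<longlongrightarrow> r\<^sup>2) (at_right r)" by (intro tendsto_intros)
    then have "\<forall>\<^sub>F q in at_right r. q\<^sup>2 < r\<^sup>2 + e" using \<open>0 < e\<close> by (intro order_tendstoD) auto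
    moreover have "\<forall>\<^sub>F q in at_right r. r < q" by (simp add: eventually_at_right_less)
    ultimately have "\<forall>\<^sub>F q in at_right r. r < q \<and> q\<^sup>2 < r\<^sup>2 + e" by eventually_elim simp
    from eventually_happens'[OF _ this] show ?thesis using that by auto
  qed
  have q0: "0 \<le> q" using q \<open>0 \<le> r\<close> by simp
  let ?S = "\<lambda>n. \<Sum>j<n. a j"
  have "\<forall>\<^sub>F n in sequentially. ?S n / real n < q" by (rule order_tendstoD(2)[OF lim q(1)])
  then obtain K where K: "\<And>n. n \<ge> K \<Longrightarrow> ?S n / real n < q" by (auto simp: eventually_sequentially)
  \<comment> \<open>The additive \<open>K\<close> makes the bound hold for every \<open>n\<close>,
    since the terms are at most 1. This uniformity is needed because \<open>n - i\<close> takes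
    small values inside the convolution.\<close>
  have S: "?S n \<le> q * real n + real K" for n
  proof (cases "n \<ge> K \<and> n > 0")
    case True
    then have "?S n < q * real n" using K[of n] by (simp add: pos_divide_less_eq)
    then show ?thesis by simp
  next
    case False
    have "?S n \<le> (\<Sum>j<n. 1)" using a by (intro sum_mono) auto
    also have "\<dots> \<le> real K" using False by auto
    also have "\<dots> \<le> q * real n + real K" using q0 by simp
    finally show ?thesis .
  qed
  \<comment> \<open>The coefficient of \<open>n\<close> after summation: \<open>q\<^sup>2\<close>
    from the triangular number, \<open>2 * q * K\<close> and \<open>2 * K\<close> from the two uses
    of the additive constant.\<close>
  define C where "C = q\<^sup>2 + 2 * q * K + 2 * K"
  have bound: "2 * (\<Sum>i<n. a i * ?S (n - i)) \<le> q\<^sup>2 * (real n)\<^sup>2 + C * real n" for n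
  proof -
    have "(\<Sum>i<n. a i * ?S (n - i)) \<le> (\<Sum>i<n. q * (a i * real (n - i)) + real K)"
    proof (rule sum_mono)
      fix i
      have "a i * ?S (n - i) \<le> a i * (q * real (n - i) + real K)"
        using a S by (intro mult_left_mono) auto
      also have "\<dots> \<le> q * (a i * real (n - i)) + real K"
        using a[of i] mult_right_mono[of "a i" 1 "real K"] by (simp add: algebra_simps)
      finally show "a i * ?S (n - i) \<le> q * (a i * real (n - i)) + real K" .
    qed
    also have "\<dots> = q * (\<Sum>m<n. ?S (Suc m)) + real n * K"
      unfolding sum.distrib sum_distrib_left[symmetric] sum_weighted_eq_sum_partial_sums by simp
    also have "\<dots> \<le> q * (\<Sum>m<n. q * real (Suc m) + real K) + real n * K"
      by (intro add_mono mult_left_mono sum_mono S q0 order_refl)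
    also have "(\<Sum>m<n. q * real (Suc m) + real K) = q * (\<Sum>m<n. real (Suc m)) + real n * K"
      unfolding sum.distrib sum_distrib_left[symmetric] by simp
    also have "(\<Sum>m<n. real (Suc m)) = ((real n)\<^sup>2 + real n) / 2"
      by (induction n) (simp_all add: power2_eq_square algebra_simps)
    finally have le: "(\<Sum>i<n. a i * ?S (n - i)) \<le>
        q * (q * (((real n)\<^sup>2 + real n) / 2) + real n * K) + real n * K" .
    have eq: "2 * (q * (q * (((real n)\<^sup>2 + real n) / 2) + real n * K) + real n * K) =
        q\<^sup>2 * (real n)\<^sup>2 + C * real n"
      by (simp add: C_def power2_eq_square algebra_simps)
    show ?thesis using mult_left_mono[OF le, of 2] unfolding eq by simp
  qed
  have "\<forall>\<^sub>F n in sequentially. C / real n < r\<^sup>2 + e - q\<^sup>2"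
    using q by (intro eventually_div_real_less) simp
  then show ?thesis
    using eventually_gt_at_top[of 0]
  proof eventually_elim
    case (elim n)
    then have "C < (r\<^sup>2 + e - q\<^sup>2) * real n" by (simp only: pos_divide_less_eq of_nat_0_less_iff)
    then have "C * real n \<le> (r\<^sup>2 + e - q\<^sup>2) * (real n)\<^sup>2"
      using mult_right_mono[of C "(r\<^sup>2 + e - q\<^sup>2) * real n" "real n"]
      by (simp add: power2_eq_square mult.assoc)
    with bound[of n] show ?case by (simp add: algebra_simps)
  qed
qed

context poisson_queue
begin

section \<open>Idle probabilities and their long-run average\<close>

lemma laplace_ge: "0 < s \<Longrightarrow> 1 - s \<le> laplace FS s"
proof -
  assume s: "0 < s"
  have "(\<integral>x. 1 - s * x \<partial>FS) \<le> (\<integral>x. exp (- s * x) \<partial>FS)"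
    using integral_FS integrable_exp_service[of s] s exp_ge_add_one_self[of "- (s * _)"]
    by (intro integral_mono) auto
  then show ?thesis using integral_FS FS.prob_space[simplified] FS.prob_space by (simp add: laplace_def)
qed

text \<open>Minus the derivative of the service transform at 0 is the mean service time. The
  difference quotients are dominated by \<open>\<bar>x\<bar>\<close>, so a first moment is
  enough.\<close>

lemma laplace_slope: "(\<lambda>i. (1 - laplace FS (1 / real (Suc i))) * real (Suc i)) \<longlonglongrightarrow> 1"
proof -
  have "(\<lambda>i. \<integral>x. (1 - exp (- (1 / real (Suc i)) * x)) * real (Suc i) \<partial>FS) \<longlonglongrightarrow> (\<integral>x. x \<partial>FS)"
  proof (rule integral_dominated_convergence[where w="\<lambda>x. \<bar>x\<bar>"])
    show "integrable FS (\<lambda>x. \<bar>x\<bar>)" using integral_FS by simp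
    show "AE x in FS. (\<lambda>i. (1 - exp (- (1 / real (Suc i)) * x)) * real (Suc i)) \<longlonglongrightarrow> x"
    proof (rule AE_I2)
      fix x :: real
      have "((\<lambda>s. exp (- s * x)) has_real_derivative - x) (at 0)"
        by (auto intro!: derivative_eq_intros)
      then have "(\<lambda>s. (exp (- s * x) - 1) / s) \<midarrow>0\<rightarrow> - x" by (simp add: DERIV_def)
      moreover have "filterlim (\<lambda>i. 1 / real (Suc i)) (at 0) sequentially"
        using LIMSEQ_inverse_real_of_nat by (auto simp: filterlim_at inverse_eq_divide)
      ultimately have "(\<lambda>i. (exp (- (1 / real (Suc i)) * x) - 1) / (1 / real (Suc i))) \<longlonglongrightarrow> - x"
        by (rule filterlim_compose)
      from tendsto_minus[OF this]
      show "(\<lambda>i. (1 - exp (- (1 / real (Suc i)) * x)) * real (Suc i)) \<longlonglongrightarrow> x"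
        by (simp add: algebra_simps)
    qed
    show "AE x in FS. norm ((1 - exp (- (1 / real (Suc i)) * x)) * real (Suc i)) \<le> \<bar>x\<bar>" for i
      using AE_service_pos
    proof eventually_elim
      case (elim x)
      have "1 - exp (- (1 / real (Suc i)) * x) \<le> (1 / real (Suc i)) * x"
        using exp_ge_add_one_self[of "- (1 / real (Suc i)) * x"] by simp
      then have "(1 - exp (- (1 / real (Suc i)) * x)) * real (Suc i) \<le> x"
        by (simp add: pos_le_divide_eq mult.commute)
      moreover have "0 \<le> (1 - exp (- (1 / real (Suc i)) * x)) * real (Suc i)"
        using elim by (intro mult_nonneg_nonneg) auto
      ultimately show ?case using elim by (simp only: real_norm_def abs_of_nonneg abs_of_pos)
    qed
  qed measurable
  moreover have "(\<integral>x. (1 - exp (- (1 / real (Suc i)) * x)) * real (Suc i) \<partial>FS) =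
      (1 - laplace FS (1 / real (Suc i))) * real (Suc i)" for i
    using integrable_exp_service[of "1 / real (Suc i)"] FS.prob_space unfolding laplace_def
    by (subst integral_mult_left_zero, subst Bochner_Integration.integral_diff) auto
  ultimately show ?thesis using integral_FS by simp
qed

text \<open>Each summand is the probability that the symbol after \<open>j\<close> finds the server
  free, i.e. that its interarrival time exceeds wait plus service of symbol
  \<open>j\<close>.\<close>

definition idle_sum :: "nat \<Rightarrow> real" where
  "idle_sum n = (\<Sum>j<n. laplace FS lam * phi lam j)"

text \<open>Summing the one-step recursion shifts the index of one sum; the boundary terms
  \<open>phi s 0 = 1\<close> and \<open>phi s n\<close> are what remains.\<close>

lemma sum_phi_identity:
  assumes "0 < s"
  shows "(s - lam + lam * laplace FS s) * (\<Sum>j<n. phi s j) = s * idle_sum n + (s - lam) * (1 - phi s n)"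
proof (induction n)
  case (Suc n)
  then show ?case using phi_Suc[OF assms, of n] by (simp add: idle_sum_def algebra_simps)
qed (simp add: phi_0 idle_sum_def)

lemma mean_wait_eq: "mean_wait n = real n * (1 - 1 / lam) + idle_sum n / lam"
proof (induction n)
  case (Suc n)
  then show ?case by (simp add: mean_wait_Suc idle_sum_def add_divide_distrib distrib_right)
qed (simp add: mean_wait_def idle_sum_def)

lemma mean_wait_nonneg: "0 \<le> mean_wait n"
  unfolding mean_wait_def by (simp add: lindley_nonneg)

lemma idle_sum_lower: "real n * (1 - lam) \<le> idle_sum n"
  using mean_wait_nonneg[of n] lam_pos unfolding mean_wait_eq by (simp add: field_simps)

text \<open>The summed identity is solved for \<open>idle_sum\<close> after bounding every
  \<open>phi s j\<close> by 1; the boundary term contributes at most \<open>lam\<close>.\<close>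

lemma idle_sum_upper:
  assumes s: "0 < s"
  shows "idle_sum n \<le> (1 - lam * ((1 - laplace FS s) / s)) * real n + lam / s"
proof -
  let ?D = "s - lam + lam * laplace FS s"
  have D: "0 \<le> ?D"
  proof -
    have "lam * (1 - s) \<le> lam * laplace FS s"
      using laplace_ge[OF s] lam_pos by (intro mult_left_mono) auto
    moreover have "lam * s \<le> s" using lam_less_1 s by simp
    ultimately show ?thesis by (simp add: algebra_simps)
  qed
  have "(\<Sum>j<n. phi s j) \<le> (\<Sum>j<n. 1)" using phi_bounds s by (intro sum_mono) auto
  then have "?D * (\<Sum>j<n. phi s j) \<le> ?D * real n" using D by (intro mult_left_mono) auto
  moreover have "- ((s - lam) * (1 - phi s n)) \<le> lam"
  proof -
    have "lam * (1 - phi s n) \<le> lam * 1" using phi_bounds[of s n] s lam_pos by (intro mult_left_mono) auto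
    moreover have "0 \<le> s * (1 - phi s n)" using phi_bounds[of s n] s by simp
    ultimately show ?thesis by (simp add: algebra_simps)
  qed
  ultimately have "s * idle_sum n \<le> ?D * real n + lam" using sum_phi_identity[OF s, of n] by simp
  then show ?thesis using s by (simp add: field_simps)
qed

text \<open>The upper bound uses the transform at \<open>s > 0\<close> and only then lets \<open>s\<close> tend to 0; this way a
  finite mean service time suffices.\<close>

lemma idle_sum_limit: "(\<lambda>n. idle_sum n / real n) \<longlonglongrightarrow> 1 - lam"
proof (rule order_tendstoI)
  fix b assume "b < 1 - lam"
  show "\<forall>\<^sub>F n in sequentially. b < idle_sum n / real n"
    using eventually_gt_at_top[of 0]
  proof eventually_elim
    case (elim n)
    then have "1 - lam \<le> idle_sum n / real n" using idle_sum_lower[of n] by (simp add: field_simps)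
    with \<open>b < 1 - lam\<close> show ?case by simp
  qed
next
  fix b assume b: "1 - lam < b"
  \<comment> \<open>The linear coefficient in \<open>idle_sum_upper\<close> tends to
    \<open>1 - lam\<close> along \<open>s = 1 / real (Suc i)\<close>. One \<open>s\<close> with
    coefficient below \<open>b\<close> is fixed before \<open>n\<close> grows.\<close>
  have "(\<lambda>i. 1 - lam * ((1 - laplace FS (1 / real (Suc i))) * real (Suc i))) \<longlonglongrightarrow> 1 - lam * 1"
    by (intro tendsto_intros laplace_slope)
  then have "\<forall>\<^sub>F i in sequentially. 1 - lam * ((1 - laplace FS (1 / real (Suc i))) * real (Suc i)) < b"
    using b by (intro order_tendstoD) auto
  then obtain i where "1 - lam * ((1 - laplace FS (1 / real (Suc i))) * real (Suc i)) < b"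
    by (auto simp: eventually_sequentially)
  then obtain s where s: "0 < s" "1 - lam * ((1 - laplace FS s) / s) < b"
    by (metis divide_divide_eq_right mult_1_right div_by_1 of_nat_0_less_iff zero_less_Suc zero_less_divide_1_iff)
  have "\<forall>\<^sub>F n in sequentially. (lam / s) / real n < b - (1 - lam * ((1 - laplace FS s) / s))"
    using s by (intro eventually_div_real_less) simp
  then show "\<forall>\<^sub>F n in sequentially. idle_sum n / real n < b"
    using eventually_gt_at_top[of 0]
  proof eventually_elim
    case (elim n)
    have "idle_sum n / real n \<le> ((1 - lam * ((1 - laplace FS s) / s)) * real n + lam / s) / real n"
      using idle_sum_upper[OF s(1), of n] by (intro divide_right_mono) auto
    also have "\<dots> = (1 - lam * ((1 - laplace FS s) / s)) + (lam / s) / real n"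
      using elim by (simp add: add_divide_distrib)
    finally show ?case using elim by simp
  qed
qed

text \<open>The linear terms of \<open>mean_wait_eq\<close> cancel in the limit. Sublinear growth
  makes the expected block duration asymptotically \<open>n / lam\<close>.\<close>

lemma mean_wait_limit: "(\<lambda>n. mean_wait n / real n) \<longlonglongrightarrow> 0"
proof -
  have "(\<lambda>n. 1 - 1 / lam + idle_sum n / real n / lam) \<longlonglongrightarrow> 1 - 1 / lam + (1 - lam) / lam"
    using lam_pos by (intro tendsto_intros idle_sum_limit) simp
  moreover have "1 - 1 / lam + (1 - lam) / lam = 0" using lam_pos by (simp add: field_simps)
  ultimately have "(\<lambda>n. 1 - 1 / lam + idle_sum n / real n / lam) \<longlonglongrightarrow> 0" by simp
  moreover have "\<forall>\<^sub>F n in sequentially. 1 - 1 / lam + idle_sum n / real n / lam = mean_wait n / real n"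
    using eventually_gt_at_top[of 0]
  proof eventually_elim
    case (elim n)
    then show ?case unfolding mean_wait_eq by (simp add: add_divide_distrib mult.commute)
  qed
  ultimately show ?thesis by (rule Lim_transform_eventually)
qed

text \<open>The Laplace transform of the stationary waiting time (Pollaczek--Khinchine).\<close>

definition stationary_laplace :: "real \<Rightarrow> real" where
  "stationary_laplace s = (1 - lam) * s / (s - lam + lam * laplace FS s)"

lemma pk_denominator_pos: "0 < s \<Longrightarrow> 0 < s - lam + lam * laplace FS s"
proof -
  assume s: "0 < s"
  have "lam * (1 - s) \<le> lam * laplace FS s"
    using laplace_ge[OF s] lam_pos by (intro mult_left_mono) auto
  moreover have "lam * s < s" using lam_less_1 s by simp
  ultimately show ?thesis by (simp add: algebra_simps)
qed

lemma stationary_laplace_pos: "0 < s \<Longrightarrow> 0 < stationary_laplace s"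
  using pk_denominator_pos lam_less_1 by (simp add: stationary_laplace_def)

text \<open>Dividing the summed identity by \<open>n\<close> removes the bounded boundary term, and
  \<open>idle_sum_limit\<close> supplies the rest.\<close>

lemma mean_phi_limit:
  assumes s: "0 < s"
  shows "(\<lambda>n. (\<Sum>j<n. phi s j) / real n) \<longlonglongrightarrow> stationary_laplace s"
proof -
  let ?D = "s - lam + lam * laplace FS s"
  have D: "0 < ?D" by (rule pk_denominator_pos[OF s])
  have rest: "(\<lambda>n. (s - lam) * (1 - phi s n) / real n) \<longlonglongrightarrow> 0"
  proof (rule tendsto_0_le[where K=1])
    show "(\<lambda>n. \<bar>s - lam\<bar> / real n) \<longlonglongrightarrow> 0" by (rule lim_const_over_n)
    have "\<bar>s - lam\<bar> * \<bar>1 - phi s n\<bar> \<le> \<bar>s - lam\<bar> * 1" for n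
      using phi_bounds[of s n] s by (intro mult_left_mono) auto
    then show "\<forall>\<^sub>F n in sequentially. norm ((s - lam) * (1 - phi s n) / real n) \<le> norm (\<bar>s - lam\<bar> / real n) * 1"
      by (auto simp: abs_mult intro!: always_eventually divide_right_mono)
  qed
  have "(\<lambda>n. (s * (idle_sum n / real n) + (s - lam) * (1 - phi s n) / real n) / ?D) \<longlonglongrightarrow> (s * (1 - lam) + 0) / ?D"
    using D by (intro tendsto_intros idle_sum_limit rest) simp
  moreover have "(s * (idle_sum n / real n) + (s - lam) * (1 - phi s n) / real n) / ?D = (\<Sum>j<n. phi s j) / real n" for n
  proof -
    have "(s * (idle_sum n / real n) + (s - lam) * (1 - phi s n) / real n) = ?D * (\<Sum>j<n. phi s j) / real n"
      unfolding sum_phi_identity[OF s] by (simp add: add_divide_distrib)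
    then show ?thesis using D by simp
  qed
  ultimately show ?thesis by (simp add: stationary_laplace_def mult.commute)
qed

end

section \<open>The capacity\<close>

lemma sum_of_bool_shift:
  fixes f :: "nat \<Rightarrow> real"
  shows "(\<Sum>j<n. of_bool (i \<le> j) * f (j - i)) = (\<Sum>k<n - i. f k)"
proof -
  have "(\<Sum>j<n. of_bool (i \<le> j) * f (j - i)) = (\<Sum>j\<in>{i..<n}. f (j - i))"
    by (intro sum.mono_neutral_cong_right) auto
  also have "\<dots> = (\<Sum>k<n - i. f k)"
    by (rule sum.reindex_bij_witness[of _ "\<lambda>k. k + i" "\<lambda>j. j - i"]) auto
  finally show ?thesis .
qed

text \<open>Chebyshev's inequality around \<open>r * real n\<close> instead of the exact mean. A
  lower bound on the first moment and an upper bound on the second suffice, because the cross term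
  enters with a negative sign.\<close>

lemma lower_tail_le:
  fixes w :: "nat set \<Rightarrow> real"
  assumes w: "\<And>E. E \<in> Pow {..<n} \<Longrightarrow> 0 \<le> w E" "(\<Sum>E\<in>Pow {..<n}. w E) = 1"
    and m1: "(r - e) * real n \<le> (\<Sum>E\<in>Pow {..<n}. w E * card E)"
    and m2: "(\<Sum>E\<in>Pow {..<n}. w E * (real (card E))\<^sup>2) \<le> (r\<^sup>2 + e) * (real n)\<^sup>2"
    and k: "real k \<le> (r - b) * real n" and "0 < b" "0 < n" "0 \<le> r"
  shows "(\<Sum>E\<in>{E\<in>Pow {..<n}. card E < k}. w E) \<le> e * (1 + 2 * r) / b\<^sup>2"
proof -
  let ?d = "\<lambda>E. (real (card E) - r * real n)\<^sup>2"
  have "(b * real n)\<^sup>2 * (\<Sum>E\<in>{E\<in>Pow {..<n}. card E < k}. w E) =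
      (\<Sum>E\<in>{E\<in>Pow {..<n}. card E < k}. w E * (b * real n)\<^sup>2)"
    by (simp add: sum_distrib_left mult.commute)
  also have "\<dots> \<le> (\<Sum>E\<in>{E\<in>Pow {..<n}. card E < k}. w E * ?d E)"
  proof (intro sum_mono mult_left_mono)
    fix E assume E: "E \<in> {E\<in>Pow {..<n}. card E < k}"
    then have "b * real n \<le> r * real n - real (card E)" using k by (simp add: algebra_simps)
    then have "(b * real n)\<^sup>2 \<le> (r * real n - real (card E))\<^sup>2" using \<open>0 < b\<close> by (intro power_mono) auto
    then show "(b * real n)\<^sup>2 \<le> ?d E" by (simp add: power2_commute)
    show "0 \<le> w E" using E w(1) by simp
  qed
  also have "\<dots> \<le> (\<Sum>E\<in>Pow {..<n}. w E * ?d E)"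
    using w(1) by (intro sum_mono2) auto
  also have "\<dots> = (\<Sum>E\<in>Pow {..<n}. w E * (real (card E))\<^sup>2 - 2 * r * real n * (w E * card E) + (r * real n)\<^sup>2 * w E)"
    by (intro sum.cong refl) (simp add: power2_eq_square algebra_simps)
  also have "\<dots> = (\<Sum>E\<in>Pow {..<n}. w E * (real (card E))\<^sup>2) - 2 * r * real n * (\<Sum>E\<in>Pow {..<n}. w E * card E) + (r * real n)\<^sup>2"
    unfolding sum.distrib sum_subtractf sum_distrib_left[symmetric] w(2) by simp
  also have "\<dots> \<le> (r\<^sup>2 + e) * (real n)\<^sup>2 - 2 * r * real n * ((r - e) * real n) + (r * real n)\<^sup>2"
    using m1 m2 \<open>0 \<le> r\<close> by (intro add_mono diff_mono mult_left_mono) auto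
  also have "\<dots> = e * (1 + 2 * r) * (real n)\<^sup>2" by (simp add: power2_eq_square algebra_simps)
  finally have "(\<Sum>E\<in>{E\<in>Pow {..<n}. card E < k}. w E) * b\<^sup>2 * (real n)\<^sup>2 \<le> e * (1 + 2 * r) * (real n)\<^sup>2"
    by (simp only: power_mult_distrib mult_ac)
  then have "(\<Sum>E\<in>{E\<in>Pow {..<n}. card E < k}. w E) * b\<^sup>2 \<le> e * (1 + 2 * r)"
    using \<open>0 < n\<close> by (simp only: mult_le_cancel_right_pos zero_less_power of_nat_0_less_iff)
  then show ?thesis using \<open>0 < b\<close> by (simp only: pos_le_divide_eq zero_less_power)
qed

text \<open>The rate \<open>R\<close> is measured in bits per symbol and \<open>L\<close> in bits per received symbol.\<close>

lemma min_power_le: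
  fixes c M L R b :: real
  assumes "c = 2 powr L" "M = 2 powr (n * R)" "0 \<le> L" "0 < n" "b < R"
  shows "min 1 (c ^ k / M) \<le> L * real k / (n * (R - b)) + 2 powr (- (n * b))"
proof (cases "n * (R - b) \<le> L * k")
  \<comment> \<open>Either the survivors carry at least \<open>n * (R - b)\<close> bits and the
    linear term alone reaches 1, or the ratio is exponentially small.\<close>
  case True
  then have "1 \<le> L * real k / (n * (R - b))" using assms by simp
  then show ?thesis by (simp add: min.coboundedI1 add_increasing2)
next
  case False
  have "c ^ k / M = 2 powr (L * k - n * R)"
    using assms by (simp add: powr_diff powr_powr flip: powr_realpow)
  also have "\<dots> \<le> 2 powr (- (n * b))" using False by (intro powr_mono) (auto simp: algebra_simps)
  finally have "c ^ k / M \<le> 2 powr (- (n * b))" .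
  moreover have "0 \<le> L * real k / (n * (R - b))" using assms by simp
  ultimately show ?thesis by (simp add: min.coboundedI2)
qed

lemma measurable_finite_PiM:
  fixes h :: "(nat \<Rightarrow> 'y::finite) \<Rightarrow> 'b"
  assumes "\<And>y. h y \<in> space N"
  shows "h \<in> measurable (\<Pi>\<^sub>M j\<in>{..<n}. count_space (UNIV :: 'y set)) N"
proof (rule measurableI)
  let ?P = "\<Pi>\<^sub>M j\<in>{..<n}. count_space (UNIV :: 'y set)"
  fix A
  have fin: "finite (space ?P)" by (simp add: space_PiM finite_PiE)
  have "{y} \<in> sets ?P" if "y \<in> space ?P" for y
  proof -
    have "{y} = (\<Pi>\<^sub>E j\<in>{..<n}. {y j})"
      using that by (intro set_eqI iffI) (auto simp: space_PiM intro: PiE_ext)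
    then show ?thesis by (simp add: sets_PiM_I_finite)
  qed
  moreover have "h -` A \<inter> space ?P = (\<Union>y\<in>h -` A \<inter> space ?P. {y})" by auto
  ultimately show "h -` A \<inter> space ?P \<in> sets ?P"
    using fin by (metis (no_types, lifting) IntD2 finite_Int sets.finite_UN)
qed (use assms in simp)

context poisson_queue
begin

section \<open>The erasure pattern averaged over the timing\<close>

definition survival :: "real \<Rightarrow> (nat \<Rightarrow> real) \<times> (nat \<Rightarrow> real) \<Rightarrow> nat \<Rightarrow> real" where
  "survival k \<omega> j = exp (- k * waiting \<omega> j)"

lemma survival_bounds: "0 \<le> k \<Longrightarrow> 0 \<le> survival k \<omega> j \<and> survival k \<omega> j \<le> 1"
  using lindley_nonneg by (simp add: survival_def waiting_eq_lindley)

lemma measurable_survival [measurable]: "(\<lambda>\<omega>. survival k \<omega> j) \<in> borel_measurable P"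
  unfolding survival_def by measurable

lemma measurable_pattern_weight [measurable]:
  "(\<lambda>\<omega>. pattern_weight (survival k \<omega>) n E) \<in> borel_measurable P"
  unfolding pattern_weight_def by measurable

definition pattern_prob :: "real \<Rightarrow> nat \<Rightarrow> nat set \<Rightarrow> real" where
  "pattern_prob k n E = (\<integral>\<omega>. pattern_weight (survival k \<omega>) n E \<partial>P)"

lemma survival_weight_bounds:
  assumes "0 \<le> k" "E \<in> Pow {..<n}"
  shows "0 \<le> pattern_weight (survival k \<omega>) n E" "pattern_weight (survival k \<omega>) n E \<le> 1"
  using pattern_weight_nonneg[of n "survival k \<omega>" E] pattern_weight_le_1[of n "survival k \<omega>" E]
    survival_bounds assms by auto

lemma integrable_pattern_weight:
  assumes "0 \<le> k" "E \<in> Pow {..<n}"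
  shows "integrable P (\<lambda>\<omega>. pattern_weight (survival k \<omega>) n E)"
  using survival_weight_bounds[OF assms]
  by (intro P.integrable_const_bound[of _ 1] AE_I2 measurable_pattern_weight) auto

lemma pattern_prob_nonneg: "0 \<le> k \<Longrightarrow> E \<in> Pow {..<n} \<Longrightarrow> 0 \<le> pattern_prob k n E"
  unfolding pattern_prob_def using survival_weight_bounds by (intro integral_nonneg_AE AE_I2) auto

lemma sum_pattern_prob_eq:
  assumes "0 \<le> k"
  shows "(\<Sum>E\<in>Pow {..<n}. pattern_prob k n E * h E) =
    (\<integral>\<omega>. (\<Sum>E\<in>Pow {..<n}. pattern_weight (survival k \<omega>) n E * h E) \<partial>P)"
proof -
  have "(\<integral>\<omega>. (\<Sum>E\<in>Pow {..<n}. pattern_weight (survival k \<omega>) n E * h E) \<partial>P) =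
      (\<Sum>E\<in>Pow {..<n}. \<integral>\<omega>. pattern_weight (survival k \<omega>) n E * h E \<partial>P)"
    by (rule Bochner_Integration.integral_sum)
      (use integrable_pattern_weight[OF assms] in \<open>auto intro: integrable_mult_left\<close>)
  then show ?thesis by (simp add: pattern_prob_def)
qed

lemma sum_pattern_prob:
  assumes "0 \<le> k"
  shows "(\<Sum>E\<in>Pow {..<n}. pattern_prob k n E) = 1"
  using sum_pattern_prob_eq[OF assms, of n "\<lambda>_. 1"] P.prob_space by (simp add: sum_pattern_weight)

lemma integral_survival: "(\<integral>\<omega>. survival k \<omega> j \<partial>P) = phi k j"
  unfolding survival_def waiting_eq_lindley phi_def
  by (rule integral_shift[of "\<lambda>\<omega>. exp (- k * lindley \<omega> j)"]) measurable

lemma integrable_survival: "0 \<le> k \<Longrightarrow> integrable P (\<lambda>\<omega>. survival k \<omega> j)"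
  using survival_bounds[of k _ j]
  by (intro P.integrable_const_bound[of _ 1] AE_I2 measurable_survival) auto

lemma sum_pattern_prob_card:
  assumes "0 \<le> k"
  shows "(\<Sum>E\<in>Pow {..<n}. pattern_prob k n E * card E) = (\<Sum>j<n. phi k j)"
  unfolding sum_pattern_prob_eq[OF assms] sum_pattern_weight_card
  by (subst Bochner_Integration.integral_sum) (auto simp: integral_survival integrable_survival assms)

text \<open>For \<open>d = 0\<close> the set is a singleton, and the bound is an equality because
  \<open>phi k 0 = 1\<close>.\<close>

lemma integral_survival_pair_le:
  assumes k: "0 \<le> k"
  shows "(\<integral>\<omega>. (\<Prod>l\<in>{i, i + d}. survival k \<omega> l) \<partial>P) \<le> phi k i * phi k d"
proof (cases "d = 0")
  case True
  then show ?thesis by (simp add: integral_survival phi_0)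
next
  case False
  have "(\<integral>\<omega>. (\<Prod>l\<in>{i, i + d}. survival k \<omega> l) \<partial>P) =
      (\<integral>\<omega>. exp (- k * lindley \<omega> i) * exp (- k * lindley \<omega> (i + d)) \<partial>P)"
    using False unfolding survival_def waiting_eq_lindley
    by (subst integral_shift[symmetric]) auto
  also have "\<dots> \<le> phi k i * phi k d" by (rule integral_exp_lindley_pair_le[OF k])
  finally show ?thesis .
qed

text \<open>Each ordered pair is bounded through its earlier index. Both orders contribute the same
  sum, hence the factor 2; counting the diagonal twice only weakens the bound.\<close>

lemma sum_pattern_prob_card_square_le:
  assumes k: "0 \<le> k"
  shows "(\<Sum>E\<in>Pow {..<n}. pattern_prob k n E * (real (card E))\<^sup>2)
    \<le> 2 * (\<Sum>i<n. phi k i * (\<Sum>d<n - i. phi k d))"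
proof -
  let ?c = "\<lambda>i j. \<integral>\<omega>. (\<Prod>l\<in>{i, j}. survival k \<omega> l) \<partial>P"
  let ?g = "\<lambda>i j. of_bool (i \<le> j) * (phi k i * phi k (j - i))"
  have int: "integrable P (\<lambda>\<omega>. \<Prod>l\<in>{i, j}. survival k \<omega> l)" for i j
  proof (rule P.integrable_const_bound[of _ 1])
    have "0 \<le> (\<Prod>l\<in>{i, j}. survival k \<omega> l)" "(\<Prod>l\<in>{i, j}. survival k \<omega> l) \<le> 1" for \<omega>
      using survival_bounds[OF k, of \<omega>] by (intro prod_nonneg prod_le_1; simp)+
    then show "AE \<omega> in P. norm (\<Prod>l\<in>{i, j}. survival k \<omega> l) \<le> 1"
      by (intro AE_I2) (simp only: real_norm_def abs_of_nonneg)
  qed measurable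
  have c: "?c i j \<le> ?g i j + ?g j i" for i j
  proof -
    have g0: "0 \<le> ?g i j" for i j using phi_bounds[OF k] by simp
    consider "i \<le> j" | "j \<le> i" by linarith
    then show ?thesis
    proof cases
      case 1
      then show ?thesis using integral_survival_pair_le[OF k, of i "j - i"] g0[of j i] by simp
    next
      case 2
      then show ?thesis using integral_survival_pair_le[OF k, of j "i - j"] g0[of i j]
        by (simp add: insert_commute)
    qed
  qed
  have G: "(\<Sum>i<n. \<Sum>j<n. ?g i j) = (\<Sum>i<n. phi k i * (\<Sum>d<n - i. phi k d))"
  proof (intro sum.cong refl)
    fix i
    have "(\<Sum>j<n. ?g i j) = phi k i * (\<Sum>j<n. of_bool (i \<le> j) * phi k (j - i))"
      by (simp add: sum_distrib_left mult_ac)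
    then show "(\<Sum>j<n. ?g i j) = phi k i * (\<Sum>d<n - i. phi k d)" by (simp only: sum_of_bool_shift)
  qed
  have "(\<Sum>E\<in>Pow {..<n}. pattern_prob k n E * (real (card E))\<^sup>2) = (\<Sum>i<n. \<Sum>j<n. ?c i j)"
    unfolding sum_pattern_prob_eq[OF k] sum_pattern_weight_card_square
    using int by (simp only: Bochner_Integration.integral_sum Bochner_Integration.integrable_sum)
  also have "\<dots> \<le> (\<Sum>i<n. \<Sum>j<n. ?g i j + ?g j i)" by (intro sum_mono c)
  also have "\<dots> = (\<Sum>i<n. \<Sum>j<n. ?g i j) + (\<Sum>i<n. \<Sum>j<n. ?g j i)" by (simp only: sum.distrib)
  also have "(\<Sum>i<n. \<Sum>j<n. ?g j i) = (\<Sum>i<n. \<Sum>j<n. ?g i j)" by (rule sum.swap)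
  finally show ?thesis unfolding G by simp
qed

text \<open>The threshold \<open>t\<close> is quantified after \<open>n\<close>, so that it may grow
  with the block length.\<close>

lemma lower_tail_limit:
  assumes k: "0 < k" and "0 < b" "0 < e"
  shows "\<forall>\<^sub>F n in sequentially. \<forall>t. real t \<le> (stationary_laplace k - b) * real n \<longrightarrow>
    (\<Sum>E\<in>{E\<in>Pow {..<n}. card E < t}. pattern_prob k n E) < e"
proof -
  define r where "r = stationary_laplace k"
  have r: "0 < r" unfolding r_def by (rule stationary_laplace_pos[OF k])
  \<comment> \<open>Chosen so that the Chebyshev bound \<open>e' * (1 + 2 * r) / b\<^sup>2\<close>
    equals \<open>e / 2\<close>.\<close>
  define e' where "e' = e * b\<^sup>2 / (2 * (1 + 2 * r))"
  have e': "0 < e'" using assms r by (simp add: e'_def)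
  have "e * b\<^sup>2 / (2 * t) * t / b\<^sup>2 = e / 2" if "t \<noteq> 0" for t
    using that \<open>0 < b\<close> by (simp add: field_simps)
  from this[of "1 + 2 * r"] have "e' * (1 + 2 * r) / b\<^sup>2 = e / 2"
    using r unfolding e'_def by simp
  then have small: "e' * (1 + 2 * r) / b\<^sup>2 < e" using \<open>0 < e\<close> by simp
  have lim: "(\<lambda>n. (\<Sum>j<n. phi k j) / real n) \<longlonglongrightarrow> r" unfolding r_def by (rule mean_phi_limit[OF k])
  have ev1: "\<forall>\<^sub>F n in sequentially. r - e' < (\<Sum>j<n. phi k j) / real n"
    using e' by (intro order_tendstoD(1)[OF lim]) simp
  have ev2: "\<forall>\<^sub>F n in sequentially. 2 * (\<Sum>i<n. phi k i * (\<Sum>d<n - i. phi k d)) \<le> (r\<^sup>2 + e') * (real n)\<^sup>2"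
    using phi_bounds[of k] k r e' by (intro convolution_sum_upper lim) auto
  from ev1 ev2 eventually_gt_at_top[of 0] show ?thesis
  proof eventually_elim
    case (elim n)
    show ?case
    proof (intro allI impI)
      fix t assume t: "real t \<le> (stationary_laplace k - b) * real n"
      have "(\<Sum>E\<in>{E\<in>Pow {..<n}. card E < t}. pattern_prob k n E) \<le> e' * (1 + 2 * r) / b\<^sup>2"
      proof (rule lower_tail_le)
        show "(r - e') * real n \<le> (\<Sum>E\<in>Pow {..<n}. pattern_prob k n E * card E)"
          using elim k by (simp add: sum_pattern_prob_card pos_less_divide_eq)
        show "(\<Sum>E\<in>Pow {..<n}. pattern_prob k n E * (real (card E))\<^sup>2) \<le> (r\<^sup>2 + e') * (real n)\<^sup>2"
          using sum_pattern_prob_card_square_le[of k n] k elim(2) by simp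
      qed (use t k r elim assms pattern_prob_nonneg sum_pattern_prob in \<open>auto simp: r_def\<close>)
      with small show "(\<Sum>E\<in>{E\<in>Pow {..<n}. card E < t}. pattern_prob k n E) < e" by simp
    qed
  qed
qed

section \<open>Expected time to serve a block\<close>

lemma has_bochner_integral_arrival: "has_bochner_integral P (\<lambda>\<omega>. arrival \<omega> j) (real (Suc j) / lam)"
proof -
  have "has_bochner_integral P (\<lambda>\<omega>. \<Sum>i\<le>j. fst \<omega> i) (\<Sum>i\<le>j. 1 / lam)"
    by (intro has_bochner_integral_sum has_bochner_integral_fst)
  then show ?thesis by (simp add: arrival_def)
qed

lemma has_bochner_integral_waiting: "has_bochner_integral P (\<lambda>\<omega>. waiting \<omega> j) (mean_wait j)"
proof -
  have "integrable (distr P P (\<lambda>\<omega>. (\<lambda>i. fst \<omega> (Suc i), snd \<omega>))) (\<lambda>\<omega>. lindley \<omega> j)"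
    by (simp add: distr_shift integrable_lindley)
  then have "integrable P (\<lambda>\<omega>. waiting \<omega> j)"
    unfolding waiting_eq_lindley by (rule integrable_distr[OF measurable_shift])
  moreover have "(\<integral>\<omega>. waiting \<omega> j \<partial>P) = mean_wait j"
    unfolding waiting_eq_lindley mean_wait_def by (rule integral_shift) simp
  ultimately show ?thesis by (simp add: has_bochner_integral_iff)
qed

text \<open>Under FIFO with positive services the service ends increase with the index, so the last
  symbol attains the maximum.\<close>

lemma completion_eq:
  assumes "\<forall>j. 0 < snd \<omega> j"
  shows "completion (Suc n) \<omega> = arrival \<omega> n + waiting \<omega> n + snd \<omega> n"
proof -
  let ?D = "\<lambda>j. departure \<omega> j + snd \<omega> j"
  have "?D j \<le> ?D (Suc j)" for j
    using assms[rule_format, of "Suc j"] by (simp add: departure_def)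
  then have "incseq ?D" by (rule incseq_SucI)
  then have "(MAX j\<in>{..<Suc n}. ?D j) = ?D n"
    by (intro Max_eqI) (auto simp: less_Suc_eq_le dest: incseqD)
  then show ?thesis by (simp add: completion_def departure_def)
qed

lemma measurable_completion: "completion (Suc n) \<in> borel_measurable P"
proof -
  have "(\<lambda>\<omega>. Max ((\<lambda>j. arrival \<omega> j + waiting \<omega> j + snd \<omega> j) ` {..<Suc n})) \<in> borel_measurable P"
    unfolding arrival_def by (rule borel_measurable_Max) auto
  then show ?thesis unfolding completion_def departure_def .
qed

lemma has_bochner_integral_completion:
  "has_bochner_integral P (completion (Suc n)) (real (Suc n) / lam + mean_wait n + 1)"
proof -
  have "has_bochner_integral P (\<lambda>\<omega>. arrival \<omega> n + waiting \<omega> n + snd \<omega> n) (real (Suc n) / lam + mean_wait n + 1)"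
    by (intro has_bochner_integral_add has_bochner_integral_arrival has_bochner_integral_waiting
        has_bochner_integral_snd)
  moreover have "AE \<omega> in P. completion (Suc n) \<omega> = arrival \<omega> n + waiting \<omega> n + snd \<omega> n"
    using AE_snd_pos by eventually_elim (rule completion_eq)
  ultimately show ?thesis
    by (subst has_bochner_integral_cong_AE[OF measurable_completion]) (auto simp: arrival_def)
qed

section \<open>Error probabilities as sums over erasure patterns\<close>

lemma measurable_observe:
  assumes "y \<in> {..<n} \<rightarrow>\<^sub>E UNIV"
  shows "(\<lambda>\<omega>. observe n \<omega> y) \<in> measurable P (observation_space n)"
  unfolding observe_def observation_space_def
proof (intro measurable_Pair measurable_const)
  show "y \<in> space (\<Pi>\<^sub>M j\<in>{..<n}. count_space UNIV)" using assms by (simp add: space_PiM)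
  show "(\<lambda>\<omega>. restrict (arrival \<omega>) {..<n}) \<in> measurable P (\<Pi>\<^sub>M j\<in>{..<n}. borel)"
    unfolding arrival_def by (rule measurable_restrict) measurable
  show "(\<lambda>\<omega>. restrict (departure \<omega>) {..<n}) \<in> measurable P (\<Pi>\<^sub>M j\<in>{..<n}. borel)"
    unfolding arrival_def departure_def by (rule measurable_restrict) measurable
qed

lemma measure_wrong_outputs:
  fixes x :: "nat \<Rightarrow> 'x::finite"
  assumes "0 \<le> k"
  shows "measure (output_law (\<lambda>w. 1 - exp (- k * w)) n x \<omega>)
      {y \<in> space (output_law (\<lambda>w. 1 - exp (- k * w)) n x \<omega>). g (observe n \<omega> y) \<noteq> m} =
    (\<Sum>E\<in>Pow {..<n}. pattern_weight (survival k \<omega>) n E * of_bool (g (observe n \<omega> (received n E x)) \<noteq> m))"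
proof -
  have "0 \<le> 1 - exp (- k * waiting \<omega> j) \<and> 1 - exp (- k * waiting \<omega> j) \<le> 1" for j
    using survival_bounds[OF assms, of \<omega> j] by (simp add: survival_def)
  moreover have "survival k \<omega> = (\<lambda>j. 1 - (1 - exp (- k * waiting \<omega> j)))"
    by (simp add: survival_def fun_eq_iff)
  ultimately show ?thesis
    using measure_output_law[where p="\<lambda>w. 1 - exp (- k * w)" and Q="\<lambda>y. g (observe n \<omega> y) \<noteq> m"
        and n=n and \<omega>=\<omega> and x=x] by simp
qed

text \<open>When the decision ignores the times, the timing enters only through the weights, and
  integration turns these into \<open>pattern_prob\<close>.\<close>

lemma error_prob_untimed:
  fixes f :: "nat \<Rightarrow> nat \<Rightarrow> 'x::finite"
  assumes k: "0 \<le> k"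
  shows "error_prob (\<lambda>w. 1 - exp (- k * w)) FA FS n Msg f (\<lambda>(y, a, d). h y) =
    (\<Sum>m\<in>Msg. \<Sum>E\<in>Pow {..<n}. pattern_prob k n E * of_bool (h (received n E (f m)) \<noteq> m)) / card Msg"
  unfolding error_prob_def measure_wrong_outputs[OF k] sum_pattern_prob_eq[OF k]
  by (simp add: observe_def)

text \<open>Finite-length converse. The counting bound is applied for each fixed timing and pattern,
  so it also holds for decoders that know the times; averaging over both follows.\<close>

lemma error_prob_ge:
  fixes f :: "nat \<Rightarrow> nat \<Rightarrow> 'x::finite"
  assumes k: "0 \<le> k" and Msg: "finite Msg" "Msg \<noteq> {}"
    and g: "g \<in> observation_space n \<rightarrow>\<^sub>M count_space Msg"
  shows "1 - (\<Sum>E\<in>Pow {..<n}. pattern_prob k n E * min 1 (real CARD('x) ^ card E / card Msg))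
    \<le> error_prob (\<lambda>w. 1 - exp (- k * w)) FA FS n Msg f g"
proof -
  let ?M = "real (card Msg)"
  let ?w = "\<lambda>\<omega>. pattern_weight (survival k \<omega>) n"
  let ?e = "\<lambda>\<omega> m E. of_bool (g (observe n \<omega> (received n E (f m))) \<noteq> m) :: real"
  let ?q = "\<lambda>E. min 1 (real CARD('x) ^ card E / ?M)"
  have M: "0 < ?M" using Msg by (simp add: card_gt_0_iff)
  have [measurable]: "(\<lambda>\<omega>. g (observe n \<omega> (received n E (f m)))) \<in> measurable P (count_space Msg)" for E m
    by (rule measurable_compose[OF measurable_observe[OF received_in_PiE] g])
  have int: "integrable P (\<lambda>\<omega>. \<Sum>E\<in>Pow {..<n}. ?w \<omega> E * ?e \<omega> m E)" for m
  proof (rule Bochner_Integration.integrable_sum)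
    fix E assume E: "E \<in> Pow {..<n}"
    show "integrable P (\<lambda>\<omega>. ?w \<omega> E * ?e \<omega> m E)"
    proof (rule P.integrable_const_bound[of _ 1])
      show "AE \<omega> in P. norm (?w \<omega> E * ?e \<omega> m E) \<le> 1"
        using survival_weight_bounds[OF k E] by (intro AE_I2) simp
    qed measurable
  qed
  have "1 - (\<Sum>E\<in>Pow {..<n}. pattern_prob k n E * ?q E) = (\<Sum>E\<in>Pow {..<n}. pattern_prob k n E * (1 - ?q E))"
    using sum_pattern_prob[OF k, of n] by (simp add: right_diff_distrib sum_subtractf)
  then have "?M * (1 - (\<Sum>E\<in>Pow {..<n}. pattern_prob k n E * ?q E)) =
      (\<integral>\<omega>. ?M * (\<Sum>E\<in>Pow {..<n}. ?w \<omega> E * (1 - ?q E)) \<partial>P)"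
    by (simp only: sum_pattern_prob_eq[OF k] integral_mult_right_zero)
  also have "\<dots> \<le> (\<integral>\<omega>. (\<Sum>m\<in>Msg. \<Sum>E\<in>Pow {..<n}. ?w \<omega> E * ?e \<omega> m E) \<partial>P)"
  proof (rule integral_mono)
    show "integrable P (\<lambda>\<omega>. ?M * (\<Sum>E\<in>Pow {..<n}. ?w \<omega> E * (1 - ?q E)))"
      by (intro integrable_mult_right Bochner_Integration.integrable_sum integrable_mult_left
          integrable_pattern_weight k)
    show "integrable P (\<lambda>\<omega>. \<Sum>m\<in>Msg. \<Sum>E\<in>Pow {..<n}. ?w \<omega> E * ?e \<omega> m E)"
      by (intro Bochner_Integration.integrable_sum[of Msg] int)
    fix \<omega>
    have le: "?M * (1 - ?q E) \<le> (\<Sum>m\<in>Msg. ?e \<omega> m E)" if E: "E \<in> Pow {..<n}" for E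
    proof -
      let ?c = "\<Sum>m\<in>Msg. of_bool (g (observe n \<omega> (received n E (f m))) = m) :: real"
      have "(\<Sum>m\<in>Msg. ?e \<omega> m E) = (\<Sum>m\<in>Msg. 1 - of_bool (g (observe n \<omega> (received n E (f m))) = m))"
        by (intro sum.cong refl) simp
      also have "\<dots> = ?M - ?c" unfolding sum_subtractf by simp
      finally have 1: "(\<Sum>m\<in>Msg. ?e \<omega> m E) = ?M - ?c" .
      have "?c \<le> real CARD('x) ^ card E"
        using card_correctly_decoded_le[of Msg E n "\<lambda>y. g (observe n \<omega> y)" f] Msg E by simp
      moreover have "?c \<le> (\<Sum>m\<in>Msg. 1)" by (intro sum_mono) simp
      ultimately have "?c \<le> ?M * ?q E" using M by (simp add: min_def)
      then show ?thesis unfolding 1 by (simp add: right_diff_distrib)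
    qed
    have "?M * (\<Sum>E\<in>Pow {..<n}. ?w \<omega> E * (1 - ?q E)) = (\<Sum>E\<in>Pow {..<n}. ?w \<omega> E * (?M * (1 - ?q E)))"
      by (simp add: sum_distrib_left mult_ac)
    also have "\<dots> \<le> (\<Sum>E\<in>Pow {..<n}. ?w \<omega> E * (\<Sum>m\<in>Msg. ?e \<omega> m E))"
      by (intro sum_mono mult_left_mono le survival_weight_bounds[OF k])
    also have "\<dots> = (\<Sum>m\<in>Msg. \<Sum>E\<in>Pow {..<n}. ?w \<omega> E * ?e \<omega> m E)"
      unfolding sum_distrib_left by (rule sum.swap)
    finally show "?M * (\<Sum>E\<in>Pow {..<n}. ?w \<omega> E * (1 - ?q E)) \<le> (\<Sum>m\<in>Msg. \<Sum>E\<in>Pow {..<n}. ?w \<omega> E * ?e \<omega> m E)" .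
  qed
  also have "\<dots> = (\<Sum>m\<in>Msg. \<integral>\<omega>. (\<Sum>E\<in>Pow {..<n}. ?w \<omega> E * ?e \<omega> m E) \<partial>P)"
    by (rule Bochner_Integration.integral_sum[OF int])
  also have "\<dots> = ?M * error_prob (\<lambda>w. 1 - exp (- k * w)) FA FS n Msg f g"
    unfolding error_prob_def measure_wrong_outputs[OF k] using M by simp
  finally show ?thesis using M by simp
qed

section \<open>Converse: rates above the limit force errors\<close>

text \<open>\<open>min_power_le\<close> makes the finite-length bound linear in the number of
  survivors, so only its mean enters and \<open>mean_phi_limit\<close> applies. The resulting bound
  on the probability of correct decoding stays below 1.\<close>

lemma achievable_le:
  assumes k: "0 < k" and ach: "achievable TYPE('x::finite) timed (\<lambda>w. 1 - exp (- k * w)) FA FS R"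
  shows "R \<le> lam * log 2 CARD('x) * stationary_laplace k"
proof (rule ccontr)
  define L where "L = log 2 CARD('x)"
  define r where "r = stationary_laplace k"
  have L: "0 \<le> L" "real CARD('x) = 2 powr L" by (simp_all add: L_def Suc_leI)
  have r: "0 < r" unfolding r_def by (rule stationary_laplace_pos[OF k])
  assume "\<not> ?thesis"
  then have R: "lam * L * r < R" by (simp add: L_def r_def)
  have "0 \<le> lam * L * r" using lam_pos L r by simp
  \<comment> \<open>A quarter of the gap pays for the \<open>\<delta>\<close> in the definition of
    achievability and for the margin in \<open>min_power_le\<close>, and still leaves
    \<open>L * r < z\<close>.\<close>
  define \<delta> where "\<delta> = (R - lam * L * r) / 4"
  have \<delta>: "0 < \<delta>" using R by (simp add: \<delta>_def)
  \<comment> \<open>A lower bound, uniform in \<open>n\<close>, for \<open>Rt - \<delta>\<close>; it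
    comes from \<open>T > n / lam\<close>.\<close>
  define z where "z = (R - \<delta>) / lam - \<delta>"
  have "lam * z = R - \<delta> - lam * \<delta>" using lam_pos by (simp add: z_def field_simps)
  moreover have "lam * \<delta> < \<delta>" using lam_less_1 \<delta> by simp
  moreover have "R = y + 4 * ((R - y) / 4)" for y by (simp add: diff_divide_distrib)
  from this[of "lam * L * r"] have "R = lam * L * r + 4 * \<delta>" by (simp only: \<delta>_def)
  ultimately have "lam * L * r < lam * z" using \<delta> by linarith
  then have "lam * (L * r) < lam * z" by (simp only: mult.assoc)
  then have z: "L * r < z" using lam_pos by simp
  have z0: "0 < z" using z L(1) r by (meson le_less_trans mult_nonneg_nonneg less_imp_le)
  define q where "q = L * r / z"
  have q: "0 \<le> q" "q < 1" using z z0 L r by (auto simp: q_def)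
  \<comment> \<open>Three shares of \<open>\<epsilon>\<close> separate \<open>q\<close> from 1: one
    for convergence to \<open>q\<close>, one for the exponentially small term, one for the decoding
    error.\<close>
  define \<epsilon> where "\<epsilon> = (1 - q) / 3"
  have \<epsilon>: "0 < \<epsilon>" "\<epsilon> < 1" "q = 1 - 3 * \<epsilon>"
    using q by (auto simp: \<epsilon>_def field_simps)
  have lim: "(\<lambda>n. L * ((\<Sum>j<n. phi k j) / real n) / z) \<longlonglongrightarrow> q"
    unfolding r_def q_def using z0 by (intro tendsto_intros mean_phi_limit[OF k]) simp
  have ev1: "\<forall>\<^sub>F n in sequentially. L * ((\<Sum>j<n. phi k j) / real n) / z < 1 - 2 * \<epsilon>"
    using \<epsilon> by (intro order_tendstoD(2)[OF lim]) simp
  have "(\<lambda>n. (2 powr (- \<delta>)) ^ n) \<longlonglongrightarrow> 0"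
    using \<delta> by (intro LIMSEQ_power_zero) (simp add: powr_minus_divide)
  then have ev2: "\<forall>\<^sub>F n in sequentially. (2 powr (- \<delta>)) ^ n < \<epsilon>"
    using \<epsilon>(1) by (rule order_tendstoD(2))
  have ev3: "\<forall>\<^sub>F n in sequentially. \<exists>Rt T Msg (f :: nat \<Rightarrow> nat \<Rightarrow> 'x) g.
      queue_code timed FA FS n Rt T Msg f g \<and>
      error_prob (\<lambda>w. 1 - exp (- k * w)) FA FS n Msg f g < \<epsilon> \<and> real n * Rt / T > R - \<delta>"
    using ach \<epsilon> \<delta> unfolding achievable_def by auto
  have "\<forall>\<^sub>F n in sequentially. False"
    using ev1 ev2 ev3 eventually_gt_at_top[of 0]
  proof eventually_elim
    case (elim n)
    then obtain Rt T Msg and f :: "nat \<Rightarrow> nat \<Rightarrow> 'x" and g where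
      code: "queue_code timed FA FS n Rt T Msg f g" and
      err: "error_prob (\<lambda>w. 1 - exp (- k * w)) FA FS n Msg f g < \<epsilon>" and
      rate: "real n * Rt / T > R - \<delta>" by blast
    obtain n' where n': "n = Suc n'" using elim by (cases n) auto
    have fin: "finite Msg" and card: "real (card Msg) = 2 powr (real n * Rt)"
      and g: "g \<in> observation_space n \<rightarrow>\<^sub>M count_space Msg"
      and T: "(\<integral>\<omega>. completion n \<omega> \<partial>P) < T"
      using code by (auto simp: queue_code_def)
    have ne: "Msg \<noteq> {}" using card by auto
    have "real n / lam < T"
      using T has_bochner_integral_completion[of n'] mean_wait_nonneg[of n']
      by (simp add: n' has_bochner_integral_iff)
    then have Tn: "real n < lam * T" using lam_pos by (simp add: field_simps)
    then have T0: "0 < T" using lam_pos by (metis of_nat_0_le_iff le_less_trans zero_less_mult_pos)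
    have R\<delta>: "0 < R - \<delta>" using R \<open>0 \<le> lam * L * r\<close> by (simp add: \<delta>_def)
    have nR: "(R - \<delta>) * T < real n * Rt" using rate T0 by (simp add: pos_less_divide_eq)
    then have "0 < real n * Rt" using R\<delta> T0 by (meson less_trans mult_pos_pos)
    then have Rt0: "0 < Rt" by (simp add: zero_less_mult_iff)
    have "(R - \<delta>) * T < (lam * T) * Rt"
      using nR mult_strict_right_mono[OF Tn Rt0] by simp
    then have "R - \<delta> < lam * Rt" using T0 by (simp add: mult_ac)
    then have Rt: "z < Rt - \<delta>" using lam_pos by (simp add: z_def field_simps)
    have "1 - \<epsilon> < (\<Sum>E\<in>Pow {..<n}. pattern_prob k n E * min 1 (real CARD('x) ^ card E / card Msg))"
      using error_prob_ge[OF _ fin ne g, of k f] err k by simp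
    also have "\<dots> \<le> (\<Sum>E\<in>Pow {..<n}. pattern_prob k n E *
        (L * real (card E) / (real n * (Rt - \<delta>)) + 2 powr (- (real n * \<delta>))))"
      using elim Rt z0 k by (intro sum_mono mult_left_mono min_power_le L card pattern_prob_nonneg) auto
    also have "\<dots> = L / (real n * (Rt - \<delta>)) * (\<Sum>E\<in>Pow {..<n}. pattern_prob k n E * card E) +
        (\<Sum>E\<in>Pow {..<n}. pattern_prob k n E) * 2 powr (- (real n * \<delta>))"
      by (simp add: distrib_left sum.distrib sum_distrib_left sum_distrib_right mult_ac)
    also have "\<dots> = L * ((\<Sum>j<n. phi k j) / real n) / (Rt - \<delta>) + 2 powr (- (real n * \<delta>))"
      using k by (simp add: sum_pattern_prob_card sum_pattern_prob)
    also have "\<dots> \<le> L * ((\<Sum>j<n. phi k j) / real n) / z + 2 powr (- (real n * \<delta>))"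
    proof (intro add_right_mono divide_left_mono)
      show "0 \<le> L * ((\<Sum>j<n. phi k j) / real n)"
        using L phi_bounds[of k] k by (intro mult_nonneg_nonneg divide_nonneg_nonneg sum_nonneg) auto
    qed (use Rt z0 in auto)
    also have "2 powr (- (real n * \<delta>)) = (2 powr (- \<delta>)) ^ n"
      by (simp add: powr_powr mult.commute flip: powr_realpow)
    also have "L * ((\<Sum>j<n. phi k j) / real n) / z + (2 powr (- \<delta>)) ^ n < 1 - \<epsilon>"
      using elim(1,2) by simp
    finally show False .
  qed
  then show False by simp
qed

section \<open>Achievability by random codes\<close>

text \<open>The constant is 2, while the mean completion time has 1, so that a deadline of this form
  is strictly larger than the mean.\<close>

lemma completion_rate_limit: "(\<lambda>n. (real (Suc n) / lam + mean_wait n + 2) / real (Suc n)) \<longlonglongrightarrow> 1 / lam"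
proof -
  have inv: "(\<lambda>n. 2 / real (Suc n)) \<longlonglongrightarrow> 0"
    using LIMSEQ_Suc[OF lim_const_over_n[of 2]] by simp
  have "(\<lambda>n. mean_wait n / real n * (real n / real (Suc n))) \<longlonglongrightarrow> 0 * 1"
    by (intro tendsto_mult mean_wait_limit LIMSEQ_n_over_Suc_n)
  moreover have "mean_wait n / real n * (real n / real (Suc n)) = mean_wait n / real (Suc n)" for n
    by (cases "n = 0") (simp_all add: mean_wait_def)
  ultimately have "(\<lambda>n. 1 / lam + mean_wait n / real (Suc n) + 2 / real (Suc n)) \<longlonglongrightarrow> 1 / lam + 0 + 0"
    by (intro tendsto_intros inv) simp
  moreover have "(real (Suc n) / lam + mean_wait n + 2) / real (Suc n) =
      1 / lam + mean_wait n / real (Suc n) + 2 / real (Suc n)" for n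
    by (simp add: add_divide_distrib del: of_nat_Suc)
  ultimately show ?thesis by (simp only: add_0_right)
qed

text \<open>The code has \<open>CARD('x) ^ K n\<close> messages with \<open>K n\<close> about
  \<open>(r - 2 * b) * n\<close>. Demanding \<open>K n + d\<close> survivors stays below
  \<open>(r - b) * n\<close>, where the lower tail vanishes, and the \<open>d\<close> surplus
  symbols make collisions rare.\<close>

lemma achievable_capacity:
  assumes k: "0 < k"
  shows "achievable TYPE('x::finite) timed (\<lambda>w. 1 - exp (- k * w)) FA FS
    (lam * log 2 CARD('x) * stationary_laplace k)"
  unfolding achievable_def
proof (intro ballI allI impI)
  fix \<epsilon> \<delta> :: real assume "\<epsilon> \<in> {0<..<1}" and \<delta>: "0 < \<delta>"
  then have \<epsilon>: "0 < \<epsilon>" by simp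
  define c where "c = real CARD('x)"
  define L where "L = log 2 c"
  define r where "r = stationary_laplace k"
  have c: "1 \<le> c" by (simp add: c_def Suc_leI)
  have L: "0 \<le> L" "c = 2 powr L" using c by (simp_all add: L_def)
  have r: "0 < r" unfolding r_def by (rule stationary_laplace_pos[OF k])
  \<comment> \<open>The first bound keeps \<open>r - 2 * b\<close> positive, the second keeps the
    rate loss \<open>2 * b * (lam * L)\<close> below \<open>\<delta>\<close>; the added 1 covers
    \<open>L = 0\<close>.\<close>
  define b where "b = min (r / 4) (\<delta> / (4 * (lam * L + 1)))"
  have b: "0 < b" "2 * b < r" "2 * b * (lam * L) < \<delta>"
  proof -
    have pos: "0 < lam * L + 1" using lam_pos L by (simp add: add_nonneg_pos)
    then show "0 < b" using r \<delta> by (simp add: b_def)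
    have "b \<le> r / 4" unfolding b_def by (rule min.cobounded1)
    then show "2 * b < r" using r by linarith
    have "b * (4 * (lam * L + 1)) \<le> \<delta>" using pos by (simp add: b_def pos_le_divide_eq[symmetric])
    then show "2 * b * (lam * L) < \<delta>" using \<open>0 < b\<close> \<delta> mult_nonneg_nonneg[of b "lam * L"] lam_pos L
      by (simp add: algebra_simps)
  qed
  define a where "a = r - 2 * b"
  have a: "0 < a" using b by (simp add: a_def)
  define K where "K n = nat \<lfloor>real n * a\<rfloor>" for n
  have K: "real (K n) \<le> real n * a" "real n * a - 1 \<le> real (K n)" for n
    using a by (auto simp: K_def)
  \<comment> \<open>A constant surplus works for all block lengths. For a one-letter alphabet the
    numerator is 0, so no surplus is required.\<close>
  obtain d :: nat where d: "\<And>j. (c ^ j - 1) / c ^ (j + d) < \<epsilon> / 2"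
  proof (cases "c = 1")
    case True
    then show ?thesis using that[of 0] \<epsilon> by simp
  next
    case False
    then have "\<exists>d. (1 / c) ^ d < \<epsilon> / 2" using c \<epsilon> by (intro real_arch_pow_inv) auto
    then obtain d where d: "(1 / c) ^ d < \<epsilon> / 2" by blast
    have "(c ^ j - 1) / c ^ (j + d) < \<epsilon> / 2" for j
    proof -
      have "(c ^ j - 1) / c ^ (j + d) \<le> c ^ j / c ^ (j + d)" using c by (intro divide_right_mono) auto
      also have "\<dots> = (1 / c) ^ d" using c by (simp add: power_add power_one_over)
      also note d
      finally show ?thesis .
    qed
    then show ?thesis by (rule that)
  qed
  have ev_tail: "\<forall>\<^sub>F n in sequentially. \<forall>t. real t \<le> (r - b) * real n \<longrightarrow>
    (\<Sum>E\<in>{E\<in>Pow {..<n}. card E < t}. pattern_prob k n E) < \<epsilon> / 2"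
    unfolding r_def using k b \<epsilon> by (intro lower_tail_limit) auto
  have ev_d: "\<forall>\<^sub>F n in sequentially. real d / real n < b"
    by (rule eventually_div_real_less[OF b(1)])
  have rate: "(\<lambda>n. (a - 1 / real (Suc n)) * L / ((real (Suc n) / lam + mean_wait n + 2) / real (Suc n)))
      \<longlonglongrightarrow> (a - 0) * L / (1 / lam)"
    using lam_pos LIMSEQ_Suc[OF lim_const_over_n[of 1]]
    by (intro tendsto_intros completion_rate_limit) auto
  have "(a - 0) * L / (1 / lam) = lam * L * r - 2 * b * (lam * L)" by (simp add: a_def algebra_simps)
  then have "lam * L * r - \<delta> < (a - 0) * L / (1 / lam)" using b by simp
  from order_tendstoD(1)[OF rate this]
  \<comment> \<open>A block of length \<open>n\<close> ends with symbol \<open>n - 1\<close>, hence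
    the shift by one; \<open>1 / real n\<close> is the loss from rounding down in
    \<open>K\<close>.\<close>
  have ev_rate: "\<forall>\<^sub>F n in sequentially. n > 0 \<longrightarrow>
      lam * L * r - \<delta> < (a - 1 / real n) * L / ((real n / lam + mean_wait (n - 1) + 2) / real n)"
    by (subst eventually_sequentially_Suc[symmetric]) (auto elim: eventually_mono)
  show "\<forall>\<^sub>F n in sequentially. \<exists>Rt T Msg (f :: nat \<Rightarrow> nat \<Rightarrow> 'x) g.
      queue_code timed FA FS n Rt T Msg f g \<and>
      error_prob (\<lambda>w. 1 - exp (- k * w)) FA FS n Msg f g < \<epsilon> \<and>
      real n * Rt / T > lam * log 2 CARD('x) * stationary_laplace k - \<delta>"
    using ev_tail ev_d ev_rate eventually_gt_at_top[of 0]
  proof eventually_elim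
    case (elim n)
    obtain n' where n': "n = Suc n'" using elim by (cases n) auto
    define M where "M = CARD('x) ^ K n"
    define Rt where "Rt = real (K n) * L / real n"
    define T where "T = real n / lam + mean_wait (n - 1) + 2"
    have M: "0 < M" "real M = c ^ K n" by (simp_all add: M_def c_def)
    have T0: "0 < T" using lam_pos mean_wait_nonneg[of "n - 1"] by (simp add: T_def add_nonneg_pos)
    obtain f :: "nat \<Rightarrow> nat \<Rightarrow> 'x" where f: "f \<in> {..<M} \<rightarrow> ({..<n} \<rightarrow>\<^sub>E UNIV)"
      and err: "(\<Sum>m<M. \<Sum>E\<in>Pow {..<n}. pattern_prob k n E *
          of_bool (first_compatible n M f (received n E (f m)) \<noteq> m)) / M
        \<le> (\<Sum>E\<in>{E\<in>Pow {..<n}. card E < K n + d}. pattern_prob k n E) + (real M - 1) / c ^ (K n + d)"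
      using exists_codebook[of n "pattern_prob k n" M "K n + d"] k M
        pattern_prob_nonneg[of k] sum_pattern_prob[of k n]
      unfolding c_def by auto
    let ?g = "\<lambda>(y, a :: nat \<Rightarrow> real, d :: nat \<Rightarrow> real). first_compatible n M f y"
    have "queue_code timed FA FS n Rt T {..<M} f ?g"
      unfolding queue_code_def
    proof (intro conjI)
      show "real (card {..<M}) = 2 powr (real n * Rt)"
        using elim by (simp add: Rt_def M L(2) powr_powr mult.commute flip: powr_realpow)
      have "first_compatible n M f \<in> (\<Pi>\<^sub>M j\<in>{..<n}. count_space UNIV) \<rightarrow>\<^sub>M count_space {..<M}"
        using M by (intro measurable_finite_PiM) (simp add: first_compatible_less)
      then show "?g \<in> observation_space n \<rightarrow>\<^sub>M count_space {..<M}"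
        unfolding observation_space_def split_beta' by (rule measurable_compose[OF measurable_fst])
      show "timed \<or> (\<exists>h. \<forall>y a d. ?g (y, a, d) = h y)" by auto
      show "integrable P (completion n)" "(\<integral>\<omega>. completion n \<omega> \<partial>P) < T"
        using has_bochner_integral_completion[of n'] by (auto simp: n' T_def has_bochner_integral_iff)
    qed (use f in auto)
    moreover have "error_prob (\<lambda>w. 1 - exp (- k * w)) FA FS n {..<M} f ?g < \<epsilon>"
    proof -
      have "real d < b * real n" using elim by (simp add: pos_divide_less_eq)
      then have "real (K n + d) \<le> (r - b) * real n" using K(1)[of n] by (simp add: a_def algebra_simps)
      then have "(\<Sum>E\<in>{E\<in>Pow {..<n}. card E < K n + d}. pattern_prob k n E) < \<epsilon> / 2"
        using elim(1) by blast
      with d[of "K n"] have "(\<Sum>E\<in>{E\<in>Pow {..<n}. card E < K n + d}. pattern_prob k n E) +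
          (real M - 1) / c ^ (K n + d) < \<epsilon>"
        unfolding M(2) by linarith
      with err show ?thesis
        unfolding error_prob_untimed[OF less_imp_le[OF k]] card_lessThan by (rule le_less_trans)
    qed
    moreover have "real n * Rt / T > lam * log 2 CARD('x) * stationary_laplace k - \<delta>"
    proof -
      have "lam * L * r - \<delta> < (a - 1 / real n) * L / (T / real n)" using elim by (simp add: T_def)
      also have "\<dots> = ((a - 1 / real n) * real n) * L / T" by (simp add: mult_ac)
      also have "(a - 1 / real n) * real n = real n * a - 1"
        using \<open>0 < n\<close> by (simp add: algebra_simps)
      also have "(real n * a - 1) * L / T \<le> real (K n) * L / T"
        using K(2)[of n] L T0 by (intro divide_right_mono mult_right_mono) auto
      also have "\<dots> = real n * Rt / T" using elim by (simp add: Rt_def)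
      finally show ?thesis by (simp add: L_def c_def r_def)
    qed
    ultimately show ?case by blast
  qed
qed

lemma capacity_eq:
  assumes "0 < k"
  shows "capacity TYPE('x::finite) timed (\<lambda>w. 1 - exp (- k * w)) FA FS =
    ereal (lam * log 2 CARD('x) * stationary_laplace k)"
  unfolding capacity_def
proof (rule antisym)
  show "(SUP R\<in>{R. achievable TYPE('x) timed (\<lambda>w. 1 - exp (- k * w)) FA FS R}. ereal R)
      \<le> ereal (lam * log 2 CARD('x) * stationary_laplace k)"
    using achievable_le[OF assms] by (intro SUP_least) auto
  show "ereal (lam * log 2 CARD('x) * stationary_laplace k)
      \<le> (SUP R\<in>{R. achievable TYPE('x) timed (\<lambda>w. 1 - exp (- k * w)) FA FS R}. ereal R)"
    using achievable_capacity[OF assms] by (intro SUP_upper) simp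
qed

section \<open>Optimality of deterministic service\<close>

text \<open>Jensen's inequality via the tangent of \<open>exp (- s * x)\<close> at the mean
  \<open>x = 1\<close>, whose linear part integrates to 0.\<close>

lemma laplace_ge_exp:
  assumes "0 < s"
  shows "exp (- s) \<le> laplace FS s"
proof -
  have "(\<integral>x. exp (- s) * (1 - s * (x - 1)) \<partial>FS) \<le> (\<integral>x. exp (- s * x) \<partial>FS)"
  proof (rule integral_mono)
    fix x :: real
    have "exp (- s) * (1 - s * (x - 1)) \<le> exp (- s) * exp (- (s * (x - 1)))"
      using exp_ge_add_one_self[of "- (s * (x - 1))"] by (intro mult_left_mono) auto
    also have "\<dots> = exp (- s * x)" by (simp add: exp_add[symmetric] algebra_simps)
    finally show "exp (- s) * (1 - s * (x - 1)) \<le> exp (- s * x)" .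
  qed (use integral_FS integrable_exp_service[of s] assms in auto)
  then show ?thesis using integral_FS FS.prob_space by (simp add: laplace_def)
qed

end

lemma unit_mean_service_deterministic: "unit_mean_service (return borel 1)"
  unfolding unit_mean_service_def
proof (intro conjI)
  interpret prob_space "return borel (1 :: real)" by (rule prob_space_return) simp
  show "real_distribution (return borel (1 :: real))" by unfold_locales simp
  show "cdf (return borel 1) (0 :: real) = 0" unfolding cdf_deterministic by simp
  have "AE x in return borel (1 :: real). x = 1" by (subst AE_return) auto
  then have "AE x in return borel (1 :: real). norm x \<le> 1" by eventually_elim simp
  then show "integrable (return borel (1 :: real)) (\<lambda>x. x)" by (rule integrable_const_bound) simp
  show "(\<integral>x. x \<partial>return borel (1 :: real)) = 1" by (rule integral_return) auto
qed

lemma laplace_deterministic: "laplace (return borel 1) s = exp (- s)"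
  unfolding laplace_def by (subst integral_return) auto

theorem theorem4:
  fixes \<kappa> lam :: real and timed :: bool
  assumes "\<kappa> > 0" and "0 < lam" and "lam < 1"
  shows "unit_mean_service (return borel 1) \<and>
    (\<forall>FS. unit_mean_service FS \<longrightarrow>
       capacity TYPE('x::finite) timed (\<lambda>w. 1 - exp (- \<kappa> * w)) (exponential lam) FS
       \<le> capacity TYPE('x) timed (\<lambda>w. 1 - exp (- \<kappa> * w)) (exponential lam) (return borel 1))"
proof (intro conjI allI impI)
  show det: "unit_mean_service (return borel 1)" by (rule unit_mean_service_deterministic)
  fix FS assume FS: "unit_mean_service FS"
  interpret D: poisson_queue lam "return borel 1" using assms det by unfold_locales
  interpret S: poisson_queue lam FS using assms FS by unfold_locales
  \<comment> \<open>The service law enters only through its transform at \<open>\<kappa>\<close> in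
    the denominator, which is smallest for deterministic service.\<close>
  have "S.stationary_laplace \<kappa> \<le> D.stationary_laplace \<kappa>"
    unfolding S.stationary_laplace_def D.stationary_laplace_def
    using S.laplace_ge_exp[OF assms(1)] S.pk_denominator_pos[OF assms(1)]
      D.pk_denominator_pos[OF assms(1)] assms
    by (intro divide_left_mono mult_nonneg_nonneg mult_pos_pos) (auto simp: laplace_deterministic)
  moreover have "0 \<le> lam * log 2 (real CARD('x))" using assms by (simp add: Suc_leI)
  ultimately have "lam * log 2 (real CARD('x)) * S.stationary_laplace \<kappa> \<le>
      lam * log 2 (real CARD('x)) * D.stationary_laplace \<kappa>"
    by (rule mult_left_mono)
  then show "capacity TYPE('x) timed (\<lambda>w. 1 - exp (- \<kappa> * w)) (exponential lam) FS
       \<le> capacity TYPE('x) timed (\<lambda>w. 1 - exp (- \<kappa> * w)) (exponential lam) (return borel 1)"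
    unfolding S.capacity_eq[OF assms(1)] D.capacity_eq[OF assms(1)] by (simp only: ereal_less_eq)
qed

end
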